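(* Consider the sensor-network hypothesis testing model and the Decentralized Chernoff Test (DCT) described in the context, with observation cost per unit time $c\in(0,1)$. Then: (i) For all $c\in(0,1)$ and all $i\in[M]$, $\mathbb{P}^{\mathcal{C}}_i(\hat H\neq h_i)\le \min\{(M-1)c,\,1\}$. (ii) For all $i\in[M]$, $\mathbb{E}^{\mathcal{C}}_i[N]\le (1+o(1))\,\frac{|\log c|}{I(i)}$ as $c\to 0$. (iii) For all $i\in[M]$, the risk satisfies $\mathbb{R}^{\mathcal{C}}_i\le (1+o(1))\,\frac{c\,|\log c|}{I(i)}$ as $c\to0$. (iv) Let $r\ge 2$. If for all $\ell\in[L]$ and $i,j,k_1\in[M]$ one has $\mathbb{E}\big[\big(\log \frac{p^{u_{k_1}}_{i,\ell}(Y)}{p^{u_{k_1}}_{j,\ell}(Y)}\big)^r\big]<\infty$, then for all $i\in[M]$, $\mathbb{E}^{\mathcal{C}}_i[N^r]\le \Big((1+o(1))\frac{|\log c|}{I(i)}\Big)^r$ as $c\to0$.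
   Context: Model: there are $L$ sensors and $M$ mutually exclusive, exhaustive hypotheses $h_1,\dots,h_M$; $[M]=\{1,\dots,M\}$; $H^*$ denotes the true hypothesis. At every time step each sensor $\ell$ chooses a probing action from $S=\{u_1,\dots,u_M\}$; if the true hypothesis is $h_i$ and sensor $\ell$ uses action $u$, the observation it receives has density $p^{u}_{i,\ell}$. Given $H^*$, observations at different sensors are independent, and at each sensor a new observation given the action is drawn independently of the past; actions may depend causally on past observations. Standing assumptions: for all $\ell,i,j,k_1$, $D(p^{u_{k_1}}_{i,\ell}\|p^{u_{k_1}}_{j,\ell})<\infty$; for all $\ell$ and $i\ne j$ there is an action $u_{k_1}$ with $D(p^{u_{k_1}}_{i,\ell}\|p^{u_{k_1}}_{j,\ell})>0$; and the second moment of $\log\big(p^{u_{k_1}}_{i,\ell}(Y)/p^{u_{k_1}}_{j,\ell}(Y)\big)$ is finite. Here $D(\cdot\|\cdot)$ is the Kullback–Leibler divergence. Let $\mathcal Q$ be the set of probability mass functions on $S$. Define $v_{i,\ell}=\max_{q\in\mathcal Q}\min_{j\ne i}\sum_{u}q(u)D(p^u_{i,\ell}\|p^u_{j,\ell})$, $I(i)=\sum_{\ell=1}^L v_{i,\ell}$, and $\rho_{i,\ell}=v_{i,\ell}/I(i)$. DCT (decentralized setup: sensors communicate only with a fusion center). Initialization: each sensor $\ell$ sends $(v_{1,\ell},\dots,v_{M,\ell})$ to the fusion center, which sends back $(\rho_{1,\ell},\dots,\rho_{M,\ell})$. Test phase: each sensor independently runs a Chernoff test: at step $k$, with $y^{k-1}_\ell,u^{k-1}_\ell$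 its own past observations and actions, it forms $i^*_{k-1}=\arg\max_i \mathbb{P}(H^*=h_i\mid y^{k-1}_\ell,u^{k-1}_\ell)$ and draws $u_{k,\ell}$ at random according to $Q^\ell_{i^*_{k-1}}=\arg\max_{q\in\mathcal Q}\min_{j\ne i^*_{k-1}}\sum_u q(u)D(p^u_{i^*_{k-1},\ell}\|p^u_{j,\ell})$, then updates the posteriors $p_{i,\ell}(y^k_\ell,u^k_\ell)=\mathbb{P}(H^*=h_i\mid y^k_\ell,u^k_\ell)$. Whenever at time $n$ sensor $\ell$ has $\log\frac{p_{i^*_n,\ell}(y^n_\ell,u^n_\ell)}{\max_{j\ne i^*_n}p_{j,\ell}(y^n_\ell,u^n_\ell)}\ge \rho_{i^*_n,\ell}|\log c|$, it communicates the local decision $h_{i^*_n}$ to the fusion center but keeps running. The fusion center makes the final decision $\hat H=h_i$ at the first time at which the local decisions of all sensors are in favor of $h_i$, and then sends a halting message to all sensors. $N$ is the time at which the final decision is made. $\mathbb{P}^{\mathcal{C}}_i,\mathbb{E}^{\mathcal{C}}_i$ denote probability and expectation under DCT when $h_i$ is true. The risk of a test $\delta$ under $h_i$ is $\mathbb{R}^\delta_i=c\,\mathbb{E}^\delta_i[N]+\omega_i\mathbb{P}^\delta_i(\hat H\ne h_i)$, with $\omega_i>0$ a fixed cost of wrong decision. *)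

theory Defs
  imports "HOL-Probability.Probability"
begin

text \<open>Conventions: sensors are indexed by 0..L-1, hypotheses h_1..h_M by 0..M-1,
  probing actions u_1..u_M by 0..M-1.  p u i l is the density p^{u}_{i,l} w.r.t. the
  base measure mu on the observation space.\<close>

definition kl :: "'y measure \<Rightarrow> ('y \<Rightarrow> real) \<Rightarrow> ('y \<Rightarrow> real) \<Rightarrow> real" where
  "kl mu f g = (\<integral>y. f y * ln (f y / g y) \<partial>mu)"

definition action_pmfs :: "nat \<Rightarrow> (nat \<Rightarrow> real) set" where
  "action_pmfs M = {q. (\<forall>u<M. 0 \<le> q u) \<and> (\<Sum>u<M. q u) = 1}"

definition chernoff_obj ::
  "'y measure \<Rightarrow> (nat \<Rightarrow> nat \<Rightarrow> nat \<Rightarrow> 'y \<Rightarrow> real) \<Rightarrow> nat \<Rightarrow> nat \<Rightarrow> nat \<Rightarrow> (nat \<Rightarrow> real) \<Rightarrow> real" where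
  "chernoff_obj mu p M l i q =
     Min {(\<Sum>u<M. q u * kl mu (p u i l) (p u j l)) | j. j < M \<and> j \<noteq> i}"

text \<open>v_{i,l} (the max over the compact action_pmfs, written as a supremum).\<close>
definition vval :: "'y measure \<Rightarrow> (nat \<Rightarrow> nat \<Rightarrow> nat \<Rightarrow> 'y \<Rightarrow> real) \<Rightarrow> nat \<Rightarrow> nat \<Rightarrow> nat \<Rightarrow> real" where
  "vval mu p M l i = (SUP q \<in> action_pmfs M. chernoff_obj mu p M l i q)"

definition Ival :: "'y measure \<Rightarrow> (nat \<Rightarrow> nat \<Rightarrow> nat \<Rightarrow> 'y \<Rightarrow> real) \<Rightarrow> nat \<Rightarrow> nat \<Rightarrow> nat \<Rightarrow> real" where
  "Ival mu p M L i = (\<Sum>l<L. vval mu p M l i)"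

definition rho :: "'y measure \<Rightarrow> (nat \<Rightarrow> nat \<Rightarrow> nat \<Rightarrow> 'y \<Rightarrow> real) \<Rightarrow> nat \<Rightarrow> nat \<Rightarrow> nat \<Rightarrow> nat \<Rightarrow> real" where
  "rho mu p M L i l = vval mu p M l i / Ival mu p M L i"

text \<open>Likelihood of hypothesis j at sensor l given history h of (action, observation) pairs,
  and posterior under the uniform prior.\<close>
definition lik :: "(nat \<Rightarrow> nat \<Rightarrow> nat \<Rightarrow> 'y \<Rightarrow> real) \<Rightarrow> nat \<Rightarrow> (nat \<times> 'y) list \<Rightarrow> nat \<Rightarrow> real" where
  "lik p l h j = prod_list (map (\<lambda>(u, y). p u j l y) h)"

definition post :: "(nat \<Rightarrow> nat \<Rightarrow> nat \<Rightarrow> 'y \<Rightarrow> real) \<Rightarrow> nat \<Rightarrow> nat \<Rightarrow> (nat \<times> 'y) list \<Rightarrow> nat \<Rightarrow> real" where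
  "post p M l h j = lik p l h j / (\<Sum>k<M. lik p l h k)"

definition argmax_idx :: "nat \<Rightarrow> (nat \<Rightarrow> real) \<Rightarrow> nat" where
  "argmax_idx M f = (LEAST i. i < M \<and> (\<forall>j<M. f j \<le> f i))"

text \<open>Drawing an action according to the pmf q using a uniform[0,1] variable x
  (inverse-CDF sampling).\<close>
definition draw :: "nat \<Rightarrow> (nat \<Rightarrow> real) \<Rightarrow> real \<Rightarrow> nat" where
  "draw M q x = (LEAST u. u < M \<and> x \<le> (\<Sum>v\<le>u. q v))"

text \<open>History of sensor l up to time n under the local Chernoff test.
  Z k l u w: observation at sensor l at time k if action u is used; U k l w: the
  uniform randomisation variable of sensor l at time k; Qs l i: the Chernoff pmf Q^l_i.\<close>
primrec hist ::
  "(nat \<Rightarrow> nat \<Rightarrow> nat \<Rightarrow> 'y \<Rightarrow> real) \<Rightarrow> nat \<Rightarrow> (nat \<Rightarrow> nat \<Rightarrow> nat \<Rightarrow> real)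
   \<Rightarrow> (nat \<Rightarrow> nat \<Rightarrow> nat \<Rightarrow> 'a \<Rightarrow> 'y) \<Rightarrow> (nat \<Rightarrow> nat \<Rightarrow> 'a \<Rightarrow> real) \<Rightarrow> nat \<Rightarrow> 'a \<Rightarrow> nat
   \<Rightarrow> (nat \<times> 'y) list" where
  "hist p M Qs Z U l w 0 = []"
| "hist p M Qs Z U l w (Suc n) =
     (let h = hist p M Qs Z U l w n;
          a = draw M (Qs l (argmax_idx M (post p M l h))) (U (Suc n) l w)
      in h @ [(a, Z (Suc n) l a w)])"

text \<open>Sensor l sends a local decision at the current time if
  log (p_{i*} / max_{j \<noteq> i*} p_j) \<ge> th i* l, i.e. p_{i*} \<ge> exp(th i* l) * max_{j \<noteq> i*} p_j.\<close>
definition fires ::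
  "(nat \<Rightarrow> nat \<Rightarrow> nat \<Rightarrow> 'y \<Rightarrow> real) \<Rightarrow> nat \<Rightarrow> nat \<Rightarrow> (nat \<Rightarrow> nat \<Rightarrow> real) \<Rightarrow> (nat \<times> 'y) list \<Rightarrow> bool" where
  "fires p M l th h =
     (let i = argmax_idx M (post p M l h)
      in exp (th i l) * Max {post p M l h j | j. j < M \<and> j \<noteq> i} \<le> post p M l h i)"

definition dct_thr :: "'y measure \<Rightarrow> (nat \<Rightarrow> nat \<Rightarrow> nat \<Rightarrow> 'y \<Rightarrow> real) \<Rightarrow> nat \<Rightarrow> nat \<Rightarrow> real \<Rightarrow> nat \<Rightarrow> nat \<Rightarrow> real" where
  "dct_thr mu p M L c i l = rho mu p M L i l * \<bar>ln c\<bar>"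

definition lastdec ::
  "'y measure \<Rightarrow> (nat \<Rightarrow> nat \<Rightarrow> nat \<Rightarrow> 'y \<Rightarrow> real) \<Rightarrow> nat \<Rightarrow> nat \<Rightarrow> (nat \<Rightarrow> nat \<Rightarrow> nat \<Rightarrow> real)
   \<Rightarrow> (nat \<Rightarrow> nat \<Rightarrow> nat \<Rightarrow> 'a \<Rightarrow> 'y) \<Rightarrow> (nat \<Rightarrow> nat \<Rightarrow> 'a \<Rightarrow> real) \<Rightarrow> real \<Rightarrow> nat \<Rightarrow> 'a \<Rightarrow> nat
   \<Rightarrow> nat option" where
  "lastdec mu p M L Qs Z U c l w n =
     (if \<exists>m\<le>n. fires p M l (dct_thr mu p M L c) (hist p M Qs Z U l w m)
      then Some (argmax_idx M (post p M l (hist p M Qs Z U l w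
              (GREATEST m. m \<le> n \<and> fires p M l (dct_thr mu p M L c) (hist p M Qs Z U l w m)))))
      else None)"

definition dct_agree ::
  "'y measure \<Rightarrow> (nat \<Rightarrow> nat \<Rightarrow> nat \<Rightarrow> 'y \<Rightarrow> real) \<Rightarrow> nat \<Rightarrow> nat \<Rightarrow> (nat \<Rightarrow> nat \<Rightarrow> nat \<Rightarrow> real)
   \<Rightarrow> (nat \<Rightarrow> nat \<Rightarrow> nat \<Rightarrow> 'a \<Rightarrow> 'y) \<Rightarrow> (nat \<Rightarrow> nat \<Rightarrow> 'a \<Rightarrow> real) \<Rightarrow> real \<Rightarrow> 'a \<Rightarrow> nat \<Rightarrow> nat \<Rightarrow> bool" where
  "dct_agree mu p M L Qs Z U c w n i =
     (i < M \<and> (\<forall>l<L. lastdec mu p M L Qs Z U c l w n = Some i))"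

definition dct_N ::
  "'y measure \<Rightarrow> (nat \<Rightarrow> nat \<Rightarrow> nat \<Rightarrow> 'y \<Rightarrow> real) \<Rightarrow> nat \<Rightarrow> nat \<Rightarrow> (nat \<Rightarrow> nat \<Rightarrow> nat \<Rightarrow> real)
   \<Rightarrow> (nat \<Rightarrow> nat \<Rightarrow> nat \<Rightarrow> 'a \<Rightarrow> 'y) \<Rightarrow> (nat \<Rightarrow> nat \<Rightarrow> 'a \<Rightarrow> real) \<Rightarrow> real \<Rightarrow> 'a \<Rightarrow> enat" where
  "dct_N mu p M L Qs Z U c w =
     (if \<exists>n i. dct_agree mu p M L Qs Z U c w n i
      then enat (LEAST n. \<exists>i. dct_agree mu p M L Qs Z U c w n i) else \<infinity>)"

definition dct_hat ::
  "'y measure \<Rightarrow> (nat \<Rightarrow> nat \<Rightarrow> nat \<Rightarrow> 'y \<Rightarrow> real) \<Rightarrow> nat \<Rightarrow> nat \<Rightarrow> (nat \<Rightarrow> nat \<Rightarrow> nat \<Rightarrow> real)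
   \<Rightarrow> (nat \<Rightarrow> nat \<Rightarrow> nat \<Rightarrow> 'a \<Rightarrow> 'y) \<Rightarrow> (nat \<Rightarrow> nat \<Rightarrow> 'a \<Rightarrow> real) \<Rightarrow> real \<Rightarrow> 'a \<Rightarrow> nat" where
  "dct_hat mu p M L Qs Z U c w =
     (THE i. dct_agree mu p M L Qs Z U c w (the_enat (dct_N mu p M L Qs Z U c w)) i)"

definition dct_err ::
  "'y measure \<Rightarrow> (nat \<Rightarrow> nat \<Rightarrow> nat \<Rightarrow> 'y \<Rightarrow> real) \<Rightarrow> nat \<Rightarrow> nat \<Rightarrow> (nat \<Rightarrow> nat \<Rightarrow> nat \<Rightarrow> real)
   \<Rightarrow> (nat \<Rightarrow> nat \<Rightarrow> nat \<Rightarrow> 'a \<Rightarrow> 'y) \<Rightarrow> (nat \<Rightarrow> nat \<Rightarrow> 'a \<Rightarrow> real) \<Rightarrow> real \<Rightarrow> 'a measure \<Rightarrow> nat \<Rightarrow> 'a set" where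
  "dct_err mu p M L Qs Z U c P i =
     {w \<in> space P. dct_N mu p M L Qs Z U c w = \<infinity> \<or> dct_hat mu p M L Qs Z U c w \<noteq> i}"

definition enat_powr :: "enat \<Rightarrow> real \<Rightarrow> ennreal" where
  "enat_powr n r = (case n of \<infinity> \<Rightarrow> \<infinity> | enat k \<Rightarrow> ennreal (real k powr r))"

definition model_under ::
  "'y measure \<Rightarrow> (nat \<Rightarrow> nat \<Rightarrow> nat \<Rightarrow> 'y \<Rightarrow> real) \<Rightarrow> nat \<Rightarrow> nat \<Rightarrow> 'a measure
   \<Rightarrow> (nat \<Rightarrow> nat \<Rightarrow> nat \<Rightarrow> 'a \<Rightarrow> 'y) \<Rightarrow> (nat \<Rightarrow> nat \<Rightarrow> 'a \<Rightarrow> real) \<Rightarrow> nat \<Rightarrow> bool" where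
  "model_under mu p M L P Z U i \<longleftrightarrow>
     prob_space P \<and>
     (\<forall>k l u. 1 \<le> k \<and> l < L \<and> u < M \<longrightarrow>
        Z k l u \<in> measurable P mu \<and> distr P mu (Z k l u) = density mu (\<lambda>y. ennreal (p u i l y))) \<and>
     (\<forall>k l. 1 \<le> k \<and> l < L \<longrightarrow>
        U k l \<in> borel_measurable P \<and> distr P lborel (U k l) = uniform_measure lborel {0..1}) \<and>
     prob_space.indep_sets P
       (\<lambda>x. case x of
              Inl (k, l, u) \<Rightarrow> {Z k l u -` A \<inter> space P | A. A \<in> sets mu}
            | Inr (k, l) \<Rightarrow> {U k l -` A \<inter> space P | A. A \<in> sets borel})
       (Inl ` {(k, l, u). 1 \<le> k \<and> l < L \<and> u < M} \<union> Inr ` {(k, l). 1 \<le> k \<and> l < L})"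

end

theory Submission
  imports Defs "HOL-Real_Asymp.Real_Asymp"
begin

text \<open>
  Under \<open>h_i\<close> let \<open>R_n\<close> be the likelihood ratio of a wrong hypothesis \<open>j\<close> against \<open>i\<close> at one sensor.
  The history does not depend on \<open>c\<close>, and for suitable exponents \<open>t \<in> (0, 1]\<close> and rates \<open>b\<close> the
  process \<open>R_n^t exp (\<Sum>m<n. b (i*_m))\<close> is a supermartingale, so everything follows from Ville's
  inequality for it.

  With \<open>t = 1\<close>, \<open>b = 0\<close> a sensor ever decides for \<open>j\<close> with probability at most
  \<open>exp (- rho_{j,l} |log c|)\<close>; the sensors are independent and the \<open>rho_{j,l}\<close> add up to one, which
  gives (i).  With \<open>t\<close> near 1 and \<open>b\<close> charging the steps with local guess \<open>j\<close>, the number of steps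
  with a wrong guess has an exponential tail.  Hence most steps use the action law \<open>Q_i\<close>, and a
  small \<open>t\<close> shows that \<open>R_n > exp (- (1 - \<delta>) v_{i,l} n)\<close> has exponentially small probability.
  Outside these events all sensors vote for \<open>i\<close> at every time \<open>n \<ge> |log c| / ((1 - \<delta>) I(i))\<close>, so the
  moments of \<open>N\<close> of every order exceed those of this deterministic time by a constant only.
\<close>

section \<open>Chernoff coefficients of a pair of densities\<close>

text \<open>The right-hand side is the tangent at 1 of the concave function x^t. Multiplied by a
  density, it bounds the integrand of the Chernoff coefficient by a mixture of the two
  densities.\<close>

lemma powr_le_affine:
  fixes x t :: real
  assumes "0 \<le> x" "0 < t" "t \<le> 1"
  shows "x powr t \<le> 1 - t + t * x"
proof (cases "x = 0")
  case False
  have "x powr t * 1 powr (1 - t) \<le> t * x + (1 - t) * 1"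
    using assms False by (intro Youngs_inequality_0) auto
  then show ?thesis by simp
qed (use assms in simp)

lemma one_minus_powr_le:
  fixes x t :: real
  assumes "0 < x"
  shows "1 - x powr t \<le> - t * ln x"
  using assms exp_ge_add_one_self[of "t * ln x"] by (simp add: powr_def del: exp_ge_add_one_self)

text \<open>This is the integral of f^(1-t) g^t, the moment generating function under
  \<open>f\<close> of the log-likelihood ratio of \<open>g\<close> against \<open>f\<close>. Points
  where \<open>f\<close> vanishes contribute nothing, so at \<open>t = 1\<close> it is the mass of
  \<open>g\<close> where \<open>f\<close> is positive, possibly less than one.\<close>

definition chernoff_coeff :: "'y measure \<Rightarrow> ('y \<Rightarrow> real) \<Rightarrow> ('y \<Rightarrow> real) \<Rightarrow> real \<Rightarrow> real" where
  "chernoff_coeff mu f g t = (\<integral>y. f y * (g y / f y) powr t \<partial>mu)"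

text \<open>f^(1-t) g^t is unchanged when the densities and the exponents are both exchanged. This
  turns a divergence in one direction into a contraction in the other.\<close>

lemma chernoff_coeff_swap:
  assumes "\<And>y. y \<in> space mu \<Longrightarrow> 0 \<le> f y" "\<And>y. y \<in> space mu \<Longrightarrow> 0 \<le> g y" "0 < t" "t < 1"
  shows "chernoff_coeff mu f g (1 - t) = chernoff_coeff mu g f t"
  unfolding chernoff_coeff_def
proof (rule Bochner_Integration.integral_cong)
  fix y assume y: "y \<in> space mu"
  show "f y * (g y / f y) powr (1 - t) = g y * (f y / g y) powr t"
  proof (cases "f y = 0 \<or> g y = 0")
    case False
    with assms(1,2)[OF y] have pos: "0 < f y" "0 < g y" by auto
    then show ?thesis
      by (simp add: powr_def ln_div flip: exp_add)
         (simp add: exp_diff exp_add algebra_simps exp_ln)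
  qed auto
qed simp

text \<open>Finiteness of the divergence of \<open>f\<close> from \<open>g\<close> takes two
  assumptions: division by zero gives 0, so integrability alone would not detect mass of
  \<open>f\<close> where \<open>g\<close> vanishes.\<close>

locale density_pair =
  fixes mu :: "'y measure" and f g :: "'y \<Rightarrow> real"
  assumes f_meas[measurable]: "f \<in> borel_measurable mu" and f_nonneg: "\<And>y. y \<in> space mu \<Longrightarrow> 0 \<le> f y"
    and f_one: "(\<integral>\<^sup>+ y. ennreal (f y) \<partial>mu) = 1"
    and g_meas[measurable]: "g \<in> borel_measurable mu" and g_nonneg: "\<And>y. y \<in> space mu \<Longrightarrow> 0 \<le> g y"
    and g_one: "(\<integral>\<^sup>+ y. ennreal (g y) \<partial>mu) = 1"
    and ac: "AE y in mu. g y = 0 \<longrightarrow> f y = 0"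
    and kl_integrable: "integrable mu (\<lambda>y. f y * ln (f y / g y))"
begin

lemma f_integrable: "integrable mu f" and f_integral: "(\<integral>y. f y \<partial>mu) = 1"
  using f_one f_nonneg by (auto simp: integrable_iff_bounded integral_eq_nn_integral cong: nn_integral_cong)

lemma g_integrable: "integrable mu g" and g_integral: "(\<integral>y. g y \<partial>mu) = 1"
  using g_one g_nonneg by (auto simp: integrable_iff_bounded integral_eq_nn_integral cong: nn_integral_cong)

lemma integrand_le:
  assumes "y \<in> space mu" "0 < t" "t \<le> 1"
  shows "f y * (g y / f y) powr t \<le> (1 - t) * f y + t * g y"
proof (cases "f y = 0")
  case False
  with f_nonneg[OF assms(1)] have "0 < f y" by simp
  then have "f y * (g y / f y) powr t \<le> f y * (1 - t + t * (g y / f y))"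
    using powr_le_affine[of "g y / f y" t] g_nonneg assms by (intro mult_left_mono) auto
  also have "\<dots> = (1 - t) * f y + t * g y" using \<open>0 < f y\<close> by (simp add: field_simps)
  finally show ?thesis .
qed (use assms g_nonneg in auto)

lemma integrand_integrable:
  assumes "0 < t" "t \<le> 1"
  shows "integrable mu (\<lambda>y. f y * (g y / f y) powr t)"
proof (rule Bochner_Integration.integrable_bound)
  show "integrable mu (\<lambda>y. (1 - t) * f y + t * g y)" using f_integrable g_integrable by auto
  show "AE y in mu. norm (f y * (g y / f y) powr t) \<le> norm ((1 - t) * f y + t * g y)"
  proof (rule AE_I2)
    fix y assume y: "y \<in> space mu"
    have "0 \<le> (1 - t) * f y + t * g y" using assms f_nonneg[OF y] g_nonneg[OF y] by simp
    then show "norm (f y * (g y / f y) powr t) \<le> norm ((1 - t) * f y + t * g y)"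
      using integrand_le[OF y assms] f_nonneg[OF y] by (simp add: abs_mult)
  qed
qed simp

lemma nn_integral_likelihood_ratio_powr:
  assumes "0 < t" "t \<le> 1"
  shows "(\<integral>\<^sup>+ y. ennreal ((g y / f y) powr t) \<partial>density mu (\<lambda>y. ennreal (f y))) = ennreal (chernoff_coeff mu f g t)"
proof -
  have "(\<integral>\<^sup>+ y. ennreal ((g y / f y) powr t) \<partial>density mu (\<lambda>y. ennreal (f y)))
      = (\<integral>\<^sup>+ y. ennreal (f y * (g y / f y) powr t) \<partial>mu)"
    by (subst nn_integral_density) (auto intro!: nn_integral_cong simp: f_nonneg ennreal_mult')
  also have "\<dots> = ennreal (chernoff_coeff mu f g t)"
    unfolding chernoff_coeff_def using f_nonneg
    by (intro nn_integral_eq_integral integrand_integrable assms AE_I2) auto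
  finally show ?thesis .
qed

lemma chernoff_coeff_le_one:
  assumes "0 < t" "t \<le> 1"
  shows "chernoff_coeff mu f g t \<le> 1"
proof -
  have "chernoff_coeff mu f g t \<le> (\<integral>y. (1 - t) * f y + t * g y \<partial>mu)"
    unfolding chernoff_coeff_def
    using integrand_integrable[OF assms] integrand_le[OF _ assms] f_integrable g_integrable
    by (intro integral_mono) auto
  also have "\<dots> = 1" using f_integrable g_integrable f_integral g_integral by simp
  finally show ?thesis .
qed

lemma chernoff_coeff_nonneg: "0 \<le> chernoff_coeff mu f g t"
  unfolding chernoff_coeff_def using f_nonneg by (intro integral_nonneg_AE AE_I2) auto

text \<open>The derivative of the coefficient at exponent 0 is minus the divergence. The difference
  quotients run along 1/(n+1) so that dominated convergence for sequences applies.\<close>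

lemma chernoff_coeff_slope:
  "(\<lambda>n. (1 - chernoff_coeff mu f g (1 / real (Suc n))) * real (Suc n)) \<longlonglongrightarrow> kl mu f g"
proof -
  let ?t = "\<lambda>n. 1 / real (Suc n)"
  let ?F = "\<lambda>n y. (f y - f y * (g y / f y) powr ?t n) * real (Suc n)"
  have "(\<lambda>n. \<integral>y. ?F n y \<partial>mu) \<longlonglongrightarrow> (\<integral>y. f y * ln (f y / g y) \<partial>mu)"
  proof (rule integral_dominated_convergence)
    \<comment> \<open>The quotient lies between \<open>f y - g y\<close>, by the tangent bound, and
      \<open>f y * ln (f y / g y)\<close>, by exp z >= 1 + z.\<close>
    show "integrable mu (\<lambda>y. \<bar>f y * ln (f y / g y)\<bar> + f y + g y)"
      using kl_integrable f_integrable g_integrable by auto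
    show "AE y in mu. (\<lambda>n. ?F n y) \<longlonglongrightarrow> f y * ln (f y / g y)"
      using ac AE_space
    proof eventually_elim
      case (elim y)
      show ?case
      proof (cases "f y = 0")
        case False
        with elim f_nonneg[of y] g_nonneg[of y] have pos: "0 < f y" "0 < g y" by (auto simp: less_le)
        have "((\<lambda>t. (g y / f y) powr t) has_real_derivative ((g y / f y) powr 0 * ln (g y / f y))) (at 0)"
          using pos by (auto intro!: derivative_eq_intros)
        then have "((\<lambda>t. ((g y / f y) powr t - 1) / t) \<longlongrightarrow> ln (g y / f y)) (at 0)"
          using pos by (simp add: has_field_derivative_iff)
        moreover have "filterlim ?t (at 0) sequentially"
          using LIMSEQ_inverse_real_of_nat by (intro filterlim_atI) (auto simp: inverse_eq_divide simp del: of_nat_Suc)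
        ultimately have "(\<lambda>n. ((g y / f y) powr ?t n - 1) / ?t n) \<longlonglongrightarrow> ln (g y / f y)"
          by (rule filterlim_compose)
        then have "(\<lambda>n. - f y * (((g y / f y) powr ?t n - 1) / ?t n)) \<longlonglongrightarrow> - f y * ln (g y / f y)"
          by (rule tendsto_mult_left)
        moreover have "- f y * (((g y / f y) powr ?t n - 1) / ?t n) = ?F n y" for n
          by (simp add: field_simps)
        moreover have "- f y * ln (g y / f y) = f y * ln (f y / g y)"
          using pos by (simp add: ln_div algebra_simps)
        ultimately show ?thesis by simp
      qed simp
    qed
    show "AE y in mu. norm (?F n y) \<le> \<bar>f y * ln (f y / g y)\<bar> + f y + g y" for n
      using ac AE_space
    proof eventually_elim
      case (elim y)
      show ?case
      proof (cases "f y = 0")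
        case True
        with elim g_nonneg[of y] show ?thesis by simp
      next
        case False
        with elim f_nonneg[of y] g_nonneg[of y] have pos: "0 < f y" "0 < g y" by (auto simp: less_le)
        have "?F n y \<le> f y * ln (f y / g y)"
        proof -
          have "f y * (1 - (g y / f y) powr ?t n) * real (Suc n) \<le> f y * (- ?t n * ln (g y / f y)) * real (Suc n)"
            using one_minus_powr_le[of "g y / f y" "?t n"] pos
            by (intro mult_right_mono mult_left_mono) auto
          also have "\<dots> = f y * ln (f y / g y)" using pos by (simp add: ln_div field_simps)
          finally show ?thesis by (simp add: algebra_simps)
        qed
        moreover have "f y - g y \<le> ?F n y"
        proof -
          have "f y * (g y / f y) powr ?t n \<le> (1 - ?t n) * f y + ?t n * g y"
            using elim by (intro integrand_le) auto
          then have "(f y - ((1 - ?t n) * f y + ?t n * g y)) * real (Suc n) \<le> ?F n y"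
            by (intro mult_right_mono) auto
          moreover have "(f y - ((1 - ?t n) * f y + ?t n * g y)) * real (Suc n) = f y - g y"
            by (simp add: field_simps del: of_nat_Suc)
          ultimately show ?thesis by linarith
        qed
        ultimately show ?thesis using pos unfolding real_norm_def by linarith
      qed
    qed
  qed simp_all
  moreover have "(\<integral>y. ?F n y \<partial>mu) = (1 - chernoff_coeff mu f g (?t n)) * real (Suc n)" for n
    using integrand_integrable[of "?t n"] f_integrable f_integral by (simp add: chernoff_coeff_def)
  ultimately show ?thesis unfolding kl_def by simp
qed

text \<open>Gibbs' inequality: the quotients that converge to the divergence are nonnegative because
  the coefficients are at most one.\<close>

lemma kl_nonneg: "0 \<le> kl mu f g"
  by (rule LIMSEQ_le_const[OF chernoff_coeff_slope])
     (auto intro!: exI[of _ 0] mult_nonneg_nonneg chernoff_coeff_le_one)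

end

section \<open>Ville's maximal inequality\<close>

text \<open>\<open>step\<close> is the supermartingale inequality tested only on the event that the
  level \<open>a\<close> has not been reached by time \<open>n\<close>, which is all that the
  stopped process needs. Conditional expectations are avoided in this way.\<close>

lemma (in prob_space) ville_inequality:
  fixes X :: "nat \<Rightarrow> 'a \<Rightarrow> ennreal"
  assumes [measurable]: "\<And>n. X n \<in> borel_measurable M"
    and step: "\<And>n. (\<integral>\<^sup>+ w. X (Suc n) w * indicator {w \<in> space M. \<forall>m\<le>n. X m w < a} w \<partial>M)
                  \<le> (\<integral>\<^sup>+ w. X n w * indicator {w \<in> space M. \<forall>m\<le>n. X m w < a} w \<partial>M)"
  shows "a * emeasure M {w \<in> space M. \<exists>n. a \<le> X n w} \<le> (\<integral>\<^sup>+ w. X 0 w \<partial>M)"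
proof -
  define C where "C n = {w \<in> space M. \<forall>m<n. X m w < a}" for n
  have C_meas[measurable]: "C n \<in> sets M" for n unfolding C_def by measurable
  \<comment> \<open>The left side is a lower bound for the mean of the process stopped on reaching
    \<open>a\<close>. \<open>C n\<close> looks at times strictly before \<open>n\<close>, so
    \<open>X n\<close> itself is unconstrained on it.\<close>
  have stopped: "(\<integral>\<^sup>+ w. X n w * indicator (C n) w \<partial>M) + a * emeasure M (space M - C n) \<le> (\<integral>\<^sup>+ w. X 0 w \<partial>M)" for n
  proof (induction n)
    case 0
    have "C 0 = space M" by (auto simp: C_def)
    then show ?case by (auto intro!: nn_integral_mono split: split_indicator)
  next
    case (Suc n)
    have C_Suc: "C (Suc n) = {w \<in> space M. \<forall>m\<le>n. X m w < a}" by (auto simp: C_def less_Suc_eq_le)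
    have "(\<integral>\<^sup>+ w. X (Suc n) w * indicator (C (Suc n)) w \<partial>M) + a * emeasure M (space M - C (Suc n))
        \<le> (\<integral>\<^sup>+ w. X n w * indicator (C (Suc n)) w \<partial>M) + (\<integral>\<^sup>+ w. a * indicator (space M - C (Suc n)) w \<partial>M)"
      using step[of n] by (intro add_mono) (auto simp: C_Suc nn_integral_cmult)
    also have "\<dots> = (\<integral>\<^sup>+ w. X n w * indicator (C (Suc n)) w + a * indicator (space M - C (Suc n)) w \<partial>M)"
      by (subst nn_integral_add) auto
    \<comment> \<open>On \<open>C n - C (Suc n)\<close> the level is first reached at time
      \<open>n\<close>, where \<open>X n w \<ge> a\<close> pays for the new term.\<close>
    also have "\<dots> \<le> (\<integral>\<^sup>+ w. X n w * indicator (C n) w + a * indicator (space M - C n) w \<partial>M)"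
    proof (rule nn_integral_mono)
      fix w assume w: "w \<in> space M"
      have C_step: "w \<in> C (Suc n) \<longleftrightarrow> w \<in> C n \<and> X n w < a"
        using w by (auto simp: C_def less_Suc_eq)
      then show "X n w * indicator (C (Suc n)) w + a * indicator (space M - C (Suc n)) w
          \<le> X n w * indicator (C n) w + a * indicator (space M - C n) w"
        using w by (auto split: split_indicator)
    qed
    also have "\<dots> = (\<integral>\<^sup>+ w. X n w * indicator (C n) w \<partial>M) + a * emeasure M (space M - C n)"
      by (subst nn_integral_add) (auto simp: nn_integral_cmult)
    finally show ?case using Suc.IH by simp
  qed
  have "a * emeasure M (\<Union>n. space M - C n) = a * (SUP n. emeasure M (space M - C n))"
    by (subst SUP_emeasure_incseq) (auto simp: incseq_def C_def)
  also have "\<dots> = (SUP n. a * emeasure M (space M - C n))"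
    by (simp add: SUP_mult_left_ennreal)
  also have "\<dots> \<le> (\<integral>\<^sup>+ w. X 0 w \<partial>M)"
  proof (rule SUP_least)
    fix n show "a * emeasure M (space M - C n) \<le> (\<integral>\<^sup>+ w. X 0 w \<partial>M)"
      using stopped[of n] by (rule order_trans[rotated]) simp
  qed
  also have "(\<Union>n. space M - C n) = {w \<in> space M. \<exists>n. a \<le> X n w}"
    unfolding C_def using not_less by blast
  finally show ?thesis .
qed

section \<open>Independence of sigma-algebras generated by blocks of sources\<close>

lemma (in prob_space) nn_integral_mult_indep_set:
  fixes X Y :: "'a \<Rightarrow> ennreal"
  assumes indep: "indep_set (sets A) (sets B)"
    and spaces: "space A = space M" "space B = space M"
    and X: "X \<in> borel_measurable A" and Y: "Y \<in> borel_measurable B"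
  shows "(\<integral>\<^sup>+ w. X w * Y w \<partial>M) = (\<integral>\<^sup>+ w. X w \<partial>M) * (\<integral>\<^sup>+ w. Y w \<partial>M)"
proof -
  let ?F = "case_bool (sets A) (sets B)" and ?X = "case_bool X Y"
  from indep have F: "indep_sets ?F UNIV" by (simp add: indep_set_def)
  have pre: "?X b -` S \<inter> space M \<in> ?F b" if "S \<in> sets borel" for b S
    using that measurable_sets[OF X, of S] measurable_sets[OF Y, of S] spaces by (cases b) auto
  have "?F b \<subseteq> events" for b using F by (auto simp: indep_sets_def)
  then have meas: "?X b \<in> borel_measurable M" for b
    using pre by (intro measurableI) auto
  have "indep_vars (\<lambda>_. borel) ?X UNIV"
    unfolding indep_vars_def2 using meas pre by (auto intro!: indep_sets_mono_sets[OF F])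
  then have "(\<integral>\<^sup>+ w. (\<Prod>b\<in>UNIV. ?X b w) \<partial>M) = (\<Prod>b\<in>UNIV. \<integral>\<^sup>+ w. ?X b w \<partial>M)"
    by (intro indep_vars_nn_integral) auto
  then show ?thesis by (simp add: UNIV_bool mult.commute)
qed

text \<open>The generated sigma-algebra is wrapped as a measure so that measurability statements
  apply. Its own measure is zero; all integrals are taken over \<open>P\<close>.\<close>

definition subalg :: "'a measure \<Rightarrow> ('x \<Rightarrow> 'a set set) \<Rightarrow> 'x set \<Rightarrow> 'a measure" where
  "subalg P G J = sigma (space P) (\<Union>x\<in>J. G x)"

lemma space_subalg[simp]: "space (subalg P G J) = space P"
  by (simp add: subalg_def space_measure_of_conv)

context
  fixes P :: "'a measure" and G :: "'x \<Rightarrow> 'a set set" and I :: "'x set"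
  assumes sub: "\<And>x. x \<in> I \<Longrightarrow> G x \<subseteq> sets P"
begin

lemma sets_subalg:
  assumes "J \<subseteq> I"
  shows "sets (subalg P G J) = sigma_sets (space P) (\<Union>x\<in>J. G x)"
  unfolding subalg_def using assms sub sets.space_closed[of P] by (intro sets_measure_of) blast

lemma subalg_mono:
  assumes "J \<subseteq> K" "K \<subseteq> I"
  shows "sets (subalg P G J) \<subseteq> sets (subalg P G K)"
  using assms by (subst (1 2) sets_subalg) (auto intro!: sigma_sets_mono')

lemma subalg_le:
  assumes "J \<subseteq> I"
  shows "sets (subalg P G J) \<subseteq> sets P"
  using assms sub by (subst sets_subalg) (auto intro!: sets.sigma_sets_subset)

lemma measurable_subalg_mono:
  assumes "X \<in> measurable (subalg P G J) N" "J \<subseteq> K" "K \<subseteq> I"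
  shows "X \<in> measurable (subalg P G K) N"
  using assms(1) measurable_mono[OF order_refl refl subalg_mono[OF assms(2,3)]] by auto

lemma measurable_subalg_le:
  assumes "X \<in> measurable (subalg P G J) N" "J \<subseteq> I"
  shows "X \<in> measurable P N"
  using assms(1) measurable_mono[OF order_refl refl subalg_le[OF assms(2)]] by auto

lemma in_subalg:
  assumes "x \<in> J" "J \<subseteq> I" "S \<in> G x"
  shows "S \<in> sets (subalg P G J)"
  using assms by (subst sets_subalg) (auto intro: sigma_sets.Basic)

end

text \<open>A pi-lambda argument, used both to separate the past from the next step and to separate
  the sensors.\<close>

lemma (in prob_space) indep_sets_subalg:
  assumes indep: "indep_sets G I" and stable: "\<And>x. x \<in> I \<Longrightarrow> Int_stable (G x)"
    and disj: "disjoint_family_on J K" and J: "\<And>k. k \<in> K \<Longrightarrow> J k \<subseteq> I"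
  shows "indep_sets (\<lambda>k. sets (subalg M G (J k))) K"
proof -
  have G: "\<And>x. x \<in> I \<Longrightarrow> G x \<subseteq> events" using indep by (auto simp: indep_sets_def)
  have "indep_sets (\<lambda>k. sigma_sets (space M) (\<Union>x\<in>J k. G x)) K"
    using J by (intro indep_sets_collect_sigma indep_sets_mono_index[OF _ indep] disj) (auto intro: stable)
  then show ?thesis
    using sets_subalg[of I G M] G J by (auto intro: indep_sets_mono_sets)
qed

lemma (in prob_space) nn_integral_mult_subalg:
  fixes X Y :: "'a \<Rightarrow> ennreal"
  assumes "indep_sets G I" "\<And>x. x \<in> I \<Longrightarrow> Int_stable (G x)"
    and J: "J1 \<subseteq> I" "J2 \<subseteq> I" "J1 \<inter> J2 = {}"
    and X: "X \<in> borel_measurable (subalg M G J1)" and Y: "Y \<in> borel_measurable (subalg M G J2)"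
  shows "(\<integral>\<^sup>+ w. X w * Y w \<partial>M) = (\<integral>\<^sup>+ w. X w \<partial>M) * (\<integral>\<^sup>+ w. Y w \<partial>M)"
proof (rule nn_integral_mult_indep_set[OF _ _ _ X Y])
  have "indep_sets (\<lambda>b. sets (subalg M G (case_bool J1 J2 b))) UNIV"
    using J by (intro indep_sets_subalg[OF assms(1,2)]) (auto simp: disjoint_family_on_def split: bool.splits)
  then show "indep_set (sets (subalg M G J1)) (sets (subalg M G J2))"
    unfolding indep_set_def by (rule indep_sets_mono_sets) (auto split: bool.splits)
qed simp_all

section \<open>Argmax and sampling of actions\<close>

lemma
  assumes "0 < M"
  shows argmax_idx_less: "argmax_idx M f < M"
    and argmax_idx_ge: "\<And>j. j < M \<Longrightarrow> f j \<le> f (argmax_idx M f)"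
proof -
  have "Max (f ` {..<M}) \<in> f ` {..<M}" using assms by (intro Max_in) auto
  then obtain k where "k < M" "f k = Max (f ` {..<M})" by auto
  then have "k < M \<and> (\<forall>j<M. f j \<le> f k)" by auto
  then have "argmax_idx M f < M \<and> (\<forall>j<M. f j \<le> f (argmax_idx M f))"
    unfolding argmax_idx_def by (rule LeastI)
  then show "argmax_idx M f < M" "\<And>j. j < M \<Longrightarrow> f j \<le> f (argmax_idx M f)" by auto
qed

lemma argmax_idx_eqI:
  assumes "k < M" "\<And>j. j < M \<Longrightarrow> j \<noteq> k \<Longrightarrow> f j < f k"
  shows "argmax_idx M f = k"
proof (rule ccontr)
  assume neq: "argmax_idx M f \<noteq> k"
  have "0 < M" using assms(1) by simp
  then have "f (argmax_idx M f) < f k" "f k \<le> f (argmax_idx M f)"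
    using assms(2)[OF argmax_idx_less neq] argmax_idx_ge[OF _ assms(1)] by auto
  then show False by simp
qed

lemma measurable_argmax_idx:
  fixes f :: "nat \<Rightarrow> 'a \<Rightarrow> real"
  assumes f: "\<And>j. j < M \<Longrightarrow> f j \<in> borel_measurable N"
  shows "(\<lambda>w. argmax_idx M (\<lambda>j. f j w)) \<in> measurable N (count_space UNIV)"
  unfolding argmax_idx_def
proof (rule measurable_Least)
  fix k show "Measurable.pred N (\<lambda>w. k < M \<and> (\<forall>j<M. f j w \<le> f k w))"
  proof (cases "k < M")
    case True
    have "Measurable.pred N (\<lambda>w. f j w \<le> f k w)" if "j \<in> {..<M}" for j
    proof -
      have [measurable]: "f k \<in> borel_measurable N" "f j \<in> borel_measurable N"
        using f[OF True] f[of j] that by simp_all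
      show ?thesis by measurable
    qed
    then have "Measurable.pred N (\<lambda>w. \<forall>j\<in>{..<M}. f j w \<le> f k w)"
      by (intro pred_intros_finite) auto
    moreover have "(\<lambda>w. k < M \<and> (\<forall>j<M. f j w \<le> f k w)) = (\<lambda>w. \<forall>j\<in>{..<M}. f j w \<le> f k w)"
      using True by auto
    ultimately show ?thesis by simp
  qed simp
qed

text \<open>The index \<open>M - 1\<close> always qualifies, as the partial sum there is one. For
  \<open>x > 1\<close> none does and the \<open>LEAST\<close> is unspecified, hence the later demand
  that the randomisation variables be at most one everywhere.\<close>

lemma draw_less:
  assumes q: "q \<in> action_pmfs M" and x: "x \<le> 1" and M: "0 < M"
  shows "draw M q x < M" "x \<le> (\<Sum>v\<le>draw M q x. q v)"
proof -
  have "{..M - 1} = {..<M}" using M by auto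
  then have "M - 1 < M \<and> x \<le> (\<Sum>v\<le>M-1. q v)" using assms by (auto simp: action_pmfs_def)
  then have "draw M q x < M \<and> x \<le> (\<Sum>v\<le>draw M q x. q v)" unfolding draw_def by (rule LeastI)
  then show "draw M q x < M" "x \<le> (\<Sum>v\<le>draw M q x. q v)" by auto
qed

text \<open>The intervals partition (0, 1]. At \<open>x = 0\<close> the draw is action 0, while
  every interval excludes 0; in \<open>prob_draw\<close> this point is discarded as a null
  set.\<close>

lemma draw_eq_iff:
  assumes q: "q \<in> action_pmfs M" and u: "u < M" and x: "0 < x" "x \<le> 1"
  shows "draw M q x = u \<longleftrightarrow> x \<in> {(\<Sum>v<u. q v)<..(\<Sum>v\<le>u. q v)}"
proof
  assume d: "draw M q x = u"
  have "(\<Sum>v<u. q v) < x"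
  proof (cases u)
    case (Suc k)
    have "\<not> (k < M \<and> x \<le> (\<Sum>v\<le>k. q v))"
      using d Suc unfolding draw_def by (intro not_less_Least) simp
    then show ?thesis using u Suc by (auto simp: lessThan_Suc_atMost)
  qed (use x in simp)
  then show "x \<in> {(\<Sum>v<u. q v)<..(\<Sum>v\<le>u. q v)}" using draw_less[OF q x(2)] u d by auto
next
  assume a: "x \<in> {(\<Sum>v<u. q v)<..(\<Sum>v\<le>u. q v)}"
  show "draw M q x = u" unfolding draw_def
  proof (rule Least_equality)
    fix k assume k: "k < M \<and> x \<le> (\<Sum>v\<le>k. q v)"
    show "u \<le> k"
    proof (rule ccontr)
      assume "\<not> u \<le> k"
      then have "(\<Sum>v\<le>k. q v) \<le> (\<Sum>v<u. q v)"
        using q u by (intro sum_mono2) (auto simp: action_pmfs_def)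
      with a k show False by auto
    qed
  qed (use a u in auto)
qed

lemma measurable_draw[measurable]: "draw M q \<in> measurable borel (count_space UNIV)"
  unfolding draw_def by measurable

lemma prob_draw:
  assumes q: "q \<in> action_pmfs M" and u: "u < M"
  shows "emeasure (uniform_measure lborel {0..1::real}) {x. draw M q x = u} = ennreal (q u)"
proof -
  have M: "0 < M" using u by simp
  let ?a = "\<Sum>v<u. q v" and ?b = "\<Sum>v\<le>u. q v"
  have ab: "?b = ?a + q u" by (simp flip: lessThan_Suc_atMost)
  have a0: "0 \<le> ?a" using q u by (auto simp: action_pmfs_def intro!: sum_nonneg)
  have "?b \<le> (\<Sum>v<M. q v)" using q u by (intro sum_mono2) (auto simp: action_pmfs_def)
  then have b1: "?b \<le> 1" using q by (auto simp: action_pmfs_def)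
  have qu: "0 \<le> q u" using q u by (auto simp: action_pmfs_def)
  have [measurable]: "{x. draw M q x = u} \<in> sets borel"
  proof -
    have "{x \<in> space borel. draw M q x = u} \<in> sets borel" by measurable
    then show ?thesis by simp
  qed
  have "emeasure (uniform_measure lborel {0..1}) {x. draw M q x = u}
      = emeasure lborel ({0..1} \<inter> {x. draw M q x = u})"
    by (subst emeasure_uniform_measure) (auto simp: divide_ennreal_def)
  also have "\<dots> = emeasure lborel {?a<..?b}"
  proof (rule emeasure_eq_AE)
    show "AE x in lborel. (x \<in> {0..1} \<inter> {x. draw M q x = u}) = (x \<in> {?a<..?b})"
      using AE_lborel_singleton[of 0]
    proof eventually_elim
      case (elim x)
      show ?case
      proof (cases "0 < x \<and> x \<le> 1")
        case True
        then show ?thesis using draw_eq_iff[OF q u, of x] by auto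
      qed (use elim a0 b1 in auto)
    qed
  qed auto
  also have "\<dots> = ennreal (q u)" using ab qu by simp
  finally show ?thesis .
qed

lemma Int_stable_vimage: "Int_stable {f -` A \<inter> S | A. A \<in> sets N}"
proof (rule Int_stableI)
  fix a b assume "a \<in> {f -` A \<inter> S | A. A \<in> sets N}" "b \<in> {f -` A \<inter> S | A. A \<in> sets N}"
  then obtain A B where "A \<in> sets N" "B \<in> sets N" "a = f -` A \<inter> S" "b = f -` B \<inter> S" by auto
  then show "a \<inter> b \<in> {f -` A \<inter> S | A. A \<in> sets N}"
    by (auto intro!: exI[of _ "A \<inter> B"])
qed

section \<open>The model, its sources of randomness and the filtration of a sensor\<close>

text \<open>The randomisation variables are at most one at every sample point and not only almost
  surely, so that every action drawn is a valid index everywhere.\<close>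

locale dct_model =
  fixes mu :: "'y measure"
    and p :: "nat \<Rightarrow> nat \<Rightarrow> nat \<Rightarrow> 'y \<Rightarrow> real"
    and M L :: nat
    and Qs :: "nat \<Rightarrow> nat \<Rightarrow> nat \<Rightarrow> real"
    and P :: "'a measure"
    and Z :: "nat \<Rightarrow> nat \<Rightarrow> nat \<Rightarrow> 'a \<Rightarrow> 'y"
    and U :: "nat \<Rightarrow> nat \<Rightarrow> 'a \<Rightarrow> real"
    and i :: nat
  assumes M2: "2 \<le> M" and L1: "1 \<le> L"
    and dens: "\<And>u j l. u < M \<Longrightarrow> j < M \<Longrightarrow> l < L \<Longrightarrow>
                 p u j l \<in> borel_measurable mu \<and> (\<forall>y \<in> space mu. 0 \<le> p u j l y) \<and>
                 (\<integral>\<^sup>+ y. ennreal (p u j l y) \<partial>mu) = 1"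
    and kl_finite: "\<And>u j j' l. u < M \<Longrightarrow> j < M \<Longrightarrow> j' < M \<Longrightarrow> l < L \<Longrightarrow>
                 (AE y in mu. p u j' l y = 0 \<longrightarrow> p u j l y = 0) \<and>
                 integrable mu (\<lambda>y. p u j l y * ln (p u j l y / p u j' l y))"
    and kl_pos: "\<And>j j' l. j < M \<Longrightarrow> j' < M \<Longrightarrow> l < L \<Longrightarrow> j \<noteq> j' \<Longrightarrow>
                 \<exists>u<M. 0 < kl mu (p u j l) (p u j' l)"
    and Qs_opt: "\<And>l j. l < L \<Longrightarrow> j < M \<Longrightarrow>
                 Qs l j \<in> action_pmfs M \<and> chernoff_obj mu p M l j (Qs l j) = vval mu p M l j"
    and i_lt: "i < M"
    and model: "model_under mu p M L P Z U i"
    and U_le_one: "\<And>k l w. U k l w \<le> 1"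
begin

sublocale prob_space P
  using model by (simp add: model_under_def)

lemma M_pos: "0 < M"
  using M2 by simp

lemma density_pair:
  assumes "u < M" "j < M" "j' < M" "l < L"
  shows "density_pair mu (p u j l) (p u j' l)"
  using dens[of u j l] dens[of u j' l] kl_finite[OF assms] assms by unfold_locales auto

lemma p_meas: "u < M \<Longrightarrow> j < M \<Longrightarrow> l < L \<Longrightarrow> p u j l \<in> borel_measurable mu"
  using dens by blast

lemma p_nonneg: "u < M \<Longrightarrow> j < M \<Longrightarrow> l < L \<Longrightarrow> y \<in> space mu \<Longrightarrow> 0 \<le> p u j l y"
  using dens by blast

lemma Q_pmf: "l < L \<Longrightarrow> j < M \<Longrightarrow> Qs l j \<in> action_pmfs M"
  using Qs_opt by blast

lemma Q_nonneg: "l < L \<Longrightarrow> j < M \<Longrightarrow> u < M \<Longrightarrow> 0 \<le> Qs l j u"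
  using Q_pmf by (force simp: action_pmfs_def)

lemma Q_sum: "l < L \<Longrightarrow> j < M \<Longrightarrow> (\<Sum>u<M. Qs l j u) = 1"
  using Q_pmf by (force simp: action_pmfs_def)

lemma Z_meas: "1 \<le> k \<Longrightarrow> l < L \<Longrightarrow> u < M \<Longrightarrow> Z k l u \<in> measurable P mu"
  and Z_distr: "1 \<le> k \<Longrightarrow> l < L \<Longrightarrow> u < M \<Longrightarrow> distr P mu (Z k l u) = density mu (\<lambda>y. ennreal (p u i l y))"
  and U_meas: "1 \<le> k \<Longrightarrow> l < L \<Longrightarrow> U k l \<in> borel_measurable P"
  and U_distr: "1 \<le> k \<Longrightarrow> l < L \<Longrightarrow> distr P lborel (U k l) = uniform_measure lborel {0..1}"
  using model by (auto simp: model_under_def)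

definition gen :: "nat \<times> nat \<times> nat + nat \<times> nat \<Rightarrow> 'a set set" where
  "gen x = (case x of
      Inl (k, l, u) \<Rightarrow> {Z k l u -` A \<inter> space P | A. A \<in> sets mu}
    | Inr (k, l) \<Rightarrow> {U k l -` A \<inter> space P | A. A \<in> sets borel})"

definition idx :: "(nat \<times> nat \<times> nat + nat \<times> nat) set" where
  "idx = Inl ` {(k, l, u). 1 \<le> k \<and> l < L \<and> u < M} \<union> Inr ` {(k, l). 1 \<le> k \<and> l < L}"

definition sensor_idx :: "nat \<Rightarrow> (nat \<times> nat \<times> nat + nat \<times> nat) set" where
  "sensor_idx l = Inl ` {(k, l', u). 1 \<le> k \<and> l' = l \<and> u < M} \<union> Inr ` {(k, l'). 1 \<le> k \<and> l' = l}"

text \<open>These sources generate the filtration of sensor \<open>l\<close>. It also contains the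
  potential observations under actions that were not chosen, which keeps it a plain block of
  sources.\<close>

definition past_idx :: "nat \<Rightarrow> nat \<Rightarrow> (nat \<times> nat \<times> nat + nat \<times> nat) set" where
  "past_idx l n = Inl ` {(k, l', u). 1 \<le> k \<and> k \<le> n \<and> l' = l \<and> u < M} \<union>
                  Inr ` {(k, l'). 1 \<le> k \<and> k \<le> n \<and> l' = l}"

abbreviation "alg J \<equiv> subalg P gen J"

lemma sensor_idx_subset: "l < L \<Longrightarrow> sensor_idx l \<subseteq> idx"
  by (auto simp: sensor_idx_def idx_def)

lemma past_idx_subset: "past_idx l n \<subseteq> sensor_idx l"
  by (auto simp: sensor_idx_def past_idx_def)

lemma past_idx_mono: "m \<le> n \<Longrightarrow> past_idx l m \<subseteq> past_idx l n"
  by (auto simp: past_idx_def)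

lemma past_idx_idx: "l < L \<Longrightarrow> past_idx l n \<subseteq> idx"
  using sensor_idx_subset past_idx_subset by blast

lemma indep_gen: "indep_sets gen idx"
  using model by (simp add: model_under_def gen_def[abs_def] idx_def)

lemma gen_events: "x \<in> idx \<Longrightarrow> gen x \<subseteq> events"
  using indep_gen by (auto simp: indep_sets_def)

lemma Int_stable_gen: "Int_stable (gen x)"
  by (auto simp: gen_def Int_stable_vimage split: sum.split)

lemma Z_alg:
  assumes "Inl (k, l, u) \<in> J" "J \<subseteq> idx"
  shows "Z k l u \<in> measurable (alg J) mu"
proof (rule measurableI)
  have "1 \<le> k" "l < L" "u < M" using assms by (auto simp: idx_def)
  from measurable_space[OF Z_meas[OF this]]
  show "\<And>w. w \<in> space (alg J) \<Longrightarrow> Z k l u w \<in> space mu" by simp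
  show "Z k l u -` A \<inter> space (alg J) \<in> sets (alg J)" if "A \<in> sets mu" for A
    using that by (intro in_subalg[OF gen_events assms]) (auto simp: gen_def)
qed

lemma U_alg:
  assumes "Inr (k, l) \<in> J" "J \<subseteq> idx"
  shows "U k l \<in> borel_measurable (alg J)"
proof (rule measurableI)
  show "U k l -` A \<inter> space (alg J) \<in> sets (alg J)" if "A \<in> sets borel" for A
    using that by (intro in_subalg[OF gen_events assms]) (auto simp: gen_def)
qed simp

section \<open>Histories of a sensor and the law of the next step\<close>

definition H :: "nat \<Rightarrow> nat \<Rightarrow> 'a \<Rightarrow> (nat \<times> 'y) list" where
  "H l n w = hist p M Qs Z U l w n"

definition guess :: "nat \<Rightarrow> nat \<Rightarrow> 'a \<Rightarrow> nat" where
  "guess l n w = argmax_idx M (post p M l (H l n w))"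

definition action :: "nat \<Rightarrow> nat \<Rightarrow> 'a \<Rightarrow> nat" where
  "action l n w = draw M (Qs l (guess l n w)) (U (Suc n) l w)"

abbreviation "obs l n w \<equiv> Z (Suc n) l (action l n w) w"

lemma H_0: "H l 0 w = []"
  by (simp add: H_def)

lemma H_Suc: "H l (Suc n) w = H l n w @ [(action l n w, obs l n w)]"
  by (simp add: H_def action_def guess_def Let_def)

lemma lik_0: "lik p l (H l 0 w) j = 1"
  by (simp add: H_0 lik_def)

lemma lik_Suc: "lik p l (H l (Suc n) w) j = lik p l (H l n w) j * p (action l n w) j l (obs l n w)"
  by (simp add: H_Suc lik_def)

lemma guess_less: "guess l n w < M"
  unfolding guess_def by (intro argmax_idx_less M_pos)

lemma action_less: "l < L \<Longrightarrow> action l n w < M"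
  unfolding action_def by (intro draw_less Q_pmf guess_less U_le_one M_pos)

text \<open>The algebra \<open>N\<close> is left free because the lemma is used inside the induction
  for \<open>measurable_lik\<close> as well as after it.\<close>

lemma measurable_guess_if:
  assumes "\<And>j. j < M \<Longrightarrow> (\<lambda>w. lik p l (H l n w) j) \<in> borel_measurable N"
  shows "guess l n \<in> measurable N (count_space UNIV)"
proof -
  have "(\<lambda>w. argmax_idx M (\<lambda>j. lik p l (H l n w) j / (\<Sum>k<M. lik p l (H l n w) k))) \<in> measurable N (count_space UNIV)"
    using assms by (intro measurable_argmax_idx borel_measurable_divide borel_measurable_sum) auto
  then show ?thesis unfolding guess_def[abs_def] post_def[abs_def] .
qed

lemma measurable_action_if:
  assumes "guess l n \<in> measurable N (count_space UNIV)" "U (Suc n) l \<in> borel_measurable N"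
  shows "action l n \<in> measurable N (count_space UNIV)"
  unfolding action_def[abs_def]
  by (rule measurable_compose_countable[where f="\<lambda>k w. draw M (Qs l k) (U (Suc n) l w)"])
    (rule measurable_compose[OF assms(2) measurable_draw] assms(1))+

text \<open>The induction alternates: the likelihoods at time \<open>n\<close> determine the guess,
  the guess and the randomisation determine the action, and the action selects one of the potential
  observations.\<close>

lemma measurable_lik:
  assumes l: "l < L" and "j < M"
  shows "(\<lambda>w. lik p l (H l n w) j) \<in> borel_measurable (alg (past_idx l n))"
  using \<open>j < M\<close>
proof (induction n arbitrary: j)
  case 0
  then show ?case by (simp add: lik_0)
next
  case (Suc n)
  let ?N = "alg (past_idx l (Suc n))"
  note sub = past_idx_idx[OF l]
  have lift: "X \<in> measurable ?N K" if "X \<in> measurable (alg (past_idx l n)) K" for X and K :: "'k measure"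
    using past_idx_mono[of n "Suc n" l] sub by (intro measurable_subalg_mono[OF gen_events that]) auto
  have lik[measurable]: "(\<lambda>w. lik p l (H l n w) k) \<in> borel_measurable ?N" if "k < M" for k
    using Suc.IH[OF that] by (rule lift)
  have "U (Suc n) l \<in> borel_measurable ?N"
    by (rule U_alg[OF _ sub]) (auto simp: past_idx_def)
  then have act: "action l n \<in> measurable ?N (count_space UNIV)"
    using lik by (intro measurable_action_if measurable_guess_if)
  \<comment> \<open>The default 0 stands for indices that are not actions;
    \<open>action_less\<close> shows that it is never taken.\<close>
  have "(\<lambda>w. if u < M then p u j l (Z (Suc n) l u w) else 0) \<in> borel_measurable ?N" for u
  proof (cases "u < M")
    case True
    then have "Z (Suc n) l u \<in> measurable ?N mu" by (intro Z_alg[OF _ sub]) (auto simp: past_idx_def)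
    from measurable_compose[OF this p_meas[OF True Suc.prems l]] show ?thesis using True by simp
  qed simp
  from measurable_compose_countable[where f="\<lambda>u w. if u < M then p u j l (Z (Suc n) l u w) else 0", OF this act]
  have "(\<lambda>w. p (action l n w) j l (obs l n w)) \<in> borel_measurable ?N"
    by (simp only: action_less[OF l] if_True)
  then show ?case unfolding lik_Suc by (intro borel_measurable_times lik Suc.prems)
qed

lemma measurable_guess:
  assumes "l < L"
  shows "guess l n \<in> measurable (alg (past_idx l n)) (count_space UNIV)"
  using assms by (intro measurable_guess_if measurable_lik)

text \<open>The tower property in integrated form, with \<open>X\<close> a function of the past.
  After splitting by the values of guess and action, each term is a product of functions of the
  past, of the new randomisation variable and of one potential observation, which are
  independent.\<close>

lemma nn_integral_step:
  fixes X :: "'a \<Rightarrow> ennreal" and f :: "nat \<Rightarrow> 'y \<Rightarrow> ennreal"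
  assumes l: "l < L" and X: "X \<in> borel_measurable (alg (past_idx l n))"
    and f: "\<And>u. u < M \<Longrightarrow> f u \<in> borel_measurable mu"
  shows "(\<integral>\<^sup>+ w. X w * f (action l n w) (obs l n w) \<partial>P)
       = (\<integral>\<^sup>+ w. X w * (\<Sum>u<M. ennreal (Qs l (guess l n w) u) *
            (\<integral>\<^sup>+ y. f u y \<partial>density mu (\<lambda>y. ennreal (p u i l y)))) \<partial>P)"
proof -
  let ?past = "past_idx l n" and ?c = "\<lambda>u. \<integral>\<^sup>+ y. f u y \<partial>density mu (\<lambda>y. ennreal (p u i l y))"
  note sub = past_idx_idx[OF l, of n]
  let ?U = "Inr (Suc n, l) :: nat \<times> nat \<times> nat + nat \<times> nat"
  let ?Z = "\<lambda>u. Inl (Suc n, l, u) :: nat \<times> nat \<times> nat + nat \<times> nat"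
  define G where "G k w = X w * indicator {w \<in> space P. guess l n w = k} w" for k w
  define D where "D k u w = (indicator {w \<in> space P. draw M (Qs l k) (U (Suc n) l w) = u} w :: ennreal)" for k u w
  define F where "F u w = f u (Z (Suc n) l u w)" for u w
  have G: "G k \<in> borel_measurable (alg ?past)" for k
  proof -
    have "{w \<in> space (alg ?past). guess l n w = k} \<in> sets (alg ?past)"
      using measurable_guess[OF l, of n] by measurable
    then show ?thesis unfolding G_def using X by simp
  qed
  have U1: "{?U} \<subseteq> idx" using l by (auto simp: idx_def)
  have D: "D k u \<in> borel_measurable (alg {?U})" for k u
  proof -
    have "{w \<in> space (alg {?U}). draw M (Qs l k) (U (Suc n) l w) = u} \<in> sets (alg {?U})"
      using U_alg[of "Suc n" l "{?U}", OF _ U1] by measurable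
    then show ?thesis unfolding D_def by simp
  qed
  have Z1: "{?Z u} \<subseteq> idx" if "u < M" for u using l that by (auto simp: idx_def)
  have F: "F u \<in> borel_measurable (alg {?Z u})" if "u < M" for u
    unfolding F_def using f[OF that] by (rule measurable_compose[OF Z_alg, rotated 2]) (use Z1 that in auto)
  have summand: "(\<integral>\<^sup>+ w. G k w * D k u w * F u w \<partial>P) = (\<integral>\<^sup>+ w. G k w \<partial>P) * ennreal (Qs l k u) * ?c u"
    if k: "k < M" and u: "u < M" for k u
  proof -
    have "(\<integral>\<^sup>+ w. G k w * D k u w * F u w \<partial>P) = (\<integral>\<^sup>+ w. G k w * D k u w \<partial>P) * (\<integral>\<^sup>+ w. F u w \<partial>P)"
    proof (rule nn_integral_mult_subalg[OF indep_gen Int_stable_gen _ _ _ _ F[OF u]])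
      show "?past \<union> {?U} \<subseteq> idx" using sub U1 by auto
      show "{?Z u} \<subseteq> idx" by (rule Z1[OF u])
      show "(?past \<union> {?U}) \<inter> {?Z u} = {}" by (auto simp: past_idx_def)
      show "(\<lambda>w. G k w * D k u w) \<in> borel_measurable (alg (?past \<union> {?U}))"
        using sub U1 by (intro borel_measurable_times_ennreal measurable_subalg_mono[OF gen_events G]
            measurable_subalg_mono[OF gen_events D]) auto
    qed
    also have "(\<integral>\<^sup>+ w. G k w * D k u w \<partial>P) = (\<integral>\<^sup>+ w. G k w \<partial>P) * (\<integral>\<^sup>+ w. D k u w \<partial>P)"
      using sub U1 by (intro nn_integral_mult_subalg[OF indep_gen Int_stable_gen _ _ _ G D])
        (auto simp: past_idx_def)
    also have "(\<integral>\<^sup>+ w. D k u w \<partial>P) = ennreal (Qs l k u)"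
    proof -
      have [measurable]: "U (Suc n) l \<in> borel_measurable P" using U_meas l by simp
      have "(\<integral>\<^sup>+ w. D k u w \<partial>P) = emeasure P {w \<in> space P. draw M (Qs l k) (U (Suc n) l w) = u}"
        unfolding D_def by (rule nn_integral_indicator) measurable
      also have "\<dots> = emeasure (distr P lborel (U (Suc n) l)) {x \<in> space lborel. draw M (Qs l k) x = u}"
        by (subst emeasure_distr) (auto intro!: arg_cong[where f="emeasure P"])
      also have "\<dots> = ennreal (Qs l k u)"
        using prob_draw[OF Q_pmf[OF l k] u] l by (simp add: U_distr del: emeasure_uniform_measure)
      finally show ?thesis .
    qed
    also have "(\<integral>\<^sup>+ w. F u w \<partial>P) = ?c u"
    proof -
      have "(\<integral>\<^sup>+ w. F u w \<partial>P) = (\<integral>\<^sup>+ y. f u y \<partial>distr P mu (Z (Suc n) l u))"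
        unfolding F_def using l u by (intro nn_integral_distr[symmetric] Z_meas) (auto intro: f)
      then show ?thesis using l u by (simp add: Z_distr)
    qed
    finally show ?thesis .
  qed
  have [measurable]: "G k \<in> borel_measurable P" for k
    by (rule measurable_subalg_le[OF gen_events G sub])
  have [measurable]: "D k u \<in> borel_measurable P" for k u
    by (rule measurable_subalg_le[OF gen_events D U1])
  have [measurable]: "F u \<in> borel_measurable P" if "u < M" for u
    by (rule measurable_subalg_le[OF gen_events F[OF that] Z1[OF that]])
  have "(\<integral>\<^sup>+ w. X w * f (action l n w) (obs l n w) \<partial>P) = (\<integral>\<^sup>+ w. (\<Sum>k<M. \<Sum>u<M. G k w * D k u w * F u w) \<partial>P)"
  proof (rule nn_integral_cong)
    fix w assume w: "w \<in> space P"
    have "G k w * D k u w * F u w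
        = (if k = guess l n w then if u = action l n w then X w * F u w else 0 else 0)" for k u
      using w by (simp add: G_def D_def action_def)
    then have "(\<Sum>k<M. \<Sum>u<M. G k w * D k u w * F u w)
        = (\<Sum>k<M. if k = guess l n w then (\<Sum>u<M. if u = action l n w then X w * F u w else 0) else 0)"
      by (intro sum.cong refl) simp
    also have "\<dots> = X w * f (action l n w) (obs l n w)"
      using guess_less[of l n w] action_less[OF l, of n w] by (simp add: sum.delta F_def)
    finally show "X w * f (action l n w) (obs l n w) = (\<Sum>k<M. \<Sum>u<M. G k w * D k u w * F u w)" ..
  qed
  also have "\<dots> = (\<Sum>k<M. \<integral>\<^sup>+ w. (\<Sum>u<M. G k w * D k u w * F u w) \<partial>P)"
    by (rule nn_integral_sum) (auto intro!: borel_measurable_sum borel_measurable_times_ennreal)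
  also have "\<dots> = (\<Sum>k<M. \<Sum>u<M. \<integral>\<^sup>+ w. G k w * D k u w * F u w \<partial>P)"
    by (intro sum.cong refl nn_integral_sum) auto
  also have "\<dots> = (\<Sum>k<M. \<Sum>u<M. (\<integral>\<^sup>+ w. G k w \<partial>P) * ennreal (Qs l k u) * ?c u)"
    by (intro sum.cong refl summand) auto
  also have "\<dots> = (\<Sum>k<M. (\<integral>\<^sup>+ w. G k w * (\<Sum>u<M. ennreal (Qs l k u) * ?c u) \<partial>P))"
    by (subst nn_integral_multc) (auto simp: sum_distrib_left mult.assoc)
  also have "\<dots> = (\<integral>\<^sup>+ w. (\<Sum>k<M. G k w * (\<Sum>u<M. ennreal (Qs l k u) * ?c u)) \<partial>P)"
    by (subst nn_integral_sum) auto
  also have "\<dots> = (\<integral>\<^sup>+ w. X w * (\<Sum>u<M. ennreal (Qs l (guess l n w) u) * ?c u) \<partial>P)"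
  proof (rule nn_integral_cong)
    fix w assume w: "w \<in> space P"
    have "(\<Sum>k<M. G k w * (\<Sum>u<M. ennreal (Qs l k u) * ?c u))
        = (\<Sum>k<M. if k = guess l n w then X w * (\<Sum>u<M. ennreal (Qs l k u) * ?c u) else 0)"
      using w by (intro sum.cong refl) (auto simp: G_def)
    also have "\<dots> = X w * (\<Sum>u<M. ennreal (Qs l (guess l n w) u) * ?c u)"
      using guess_less[of l n w] by (simp add: sum.delta)
    finally show "(\<Sum>k<M. G k w * (\<Sum>u<M. ennreal (Qs l k u) * ?c u))
        = X w * (\<Sum>u<M. ennreal (Qs l (guess l n w) u) * ?c u)" .
  qed
  finally show ?thesis .
qed

end

section \<open>Exponentially decaying bounds\<close>

definition exp_decay :: "(nat \<Rightarrow> real) \<Rightarrow> bool" where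
  "exp_decay a \<longleftrightarrow> (\<exists>K b. 0 \<le> K \<and> 0 < b \<and> (\<forall>n. a n \<le> K * exp (- b * real n)))"

lemma exp_decayI: "0 \<le> K \<Longrightarrow> 0 < b \<Longrightarrow> (\<And>n. a n \<le> K * exp (- b * real n)) \<Longrightarrow> exp_decay a"
  unfolding exp_decay_def by blast

lemma exp_decay_mono: "exp_decay b \<Longrightarrow> (\<And>n. a n \<le> b n) \<Longrightarrow> exp_decay a"
  unfolding exp_decay_def by (meson order_trans)

lemma exp_decay_add:
  assumes "exp_decay a" "exp_decay a'"
  shows "exp_decay (\<lambda>n. a n + a' n)"
proof -
  from assms obtain K b K' b' where *: "0 \<le> K" "0 < b" "0 \<le> K'" "0 < b'"
    "\<And>n. a n \<le> K * exp (- b * real n)" "\<And>n. a' n \<le> K' * exp (- b' * real n)"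
    unfolding exp_decay_def by blast
  show ?thesis
  proof (rule exp_decayI[of "K + K'" "min b b'"])
    fix n
    have "K * exp (- b * real n) \<le> K * exp (- min b b' * real n)"
      "K' * exp (- b' * real n) \<le> K' * exp (- min b b' * real n)"
      using * by (auto intro!: mult_left_mono mult_right_mono)
    with *(5,6)[of n] show "a n + a' n \<le> (K + K') * exp (- min b b' * real n)"
      by (simp add: distrib_right)
  qed (use * in auto)
qed

lemma exp_decay_sum:
  assumes "finite A" "\<And>x. x \<in> A \<Longrightarrow> exp_decay (f x)"
  shows "exp_decay (\<lambda>n. \<Sum>x\<in>A. f x n)"
  using assms
proof (induction A rule: finite_induct)
  case empty
  then show ?case by (auto intro: exp_decayI[of 0 1])
qed (auto intro: exp_decay_add)

section \<open>Likelihood ratios and their supermartingales\<close>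

context dct_model
begin

lemma obs_space: "l < L \<Longrightarrow> w \<in> space P \<Longrightarrow> obs l n w \<in> space mu"
  using measurable_space[OF Z_meas] action_less by simp

lemma lik_nonneg:
  assumes "l < L" "j < M" "w \<in> space P"
  shows "0 \<le> lik p l (H l n w) j"
  using assms by (induction n) (auto simp: lik_0 lik_Suc intro!: mult_nonneg_nonneg p_nonneg action_less obs_space)

text \<open>Positivity is demanded of all potential observations, so the condition does not involve
  the history. At such points no likelihood vanishes.\<close>

definition regular :: "'a \<Rightarrow> bool" where
  "regular w \<longleftrightarrow> (\<forall>k l u j. l < L \<and> u < M \<and> j < M \<longrightarrow> 0 < p u j l (Z (Suc k) l u w))"

text \<open>An observation drawn under \<open>i\<close> falls where the density of \<open>i\<close>
  is positive, and absolute continuity makes the density of \<open>j\<close> positive there too.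
  Countably many null sets are discarded.\<close>

lemma AE_regular: "AE w in P. regular w"
proof -
  have "AE w in P. 0 < p u j l (Z (Suc k) l u w)" if *: "l < L" "u < M" "j < M" for k l u j
  proof -
    have [measurable]: "p u i l \<in> borel_measurable mu" using p_meas i_lt * by simp
    have "AE y in mu. 0 < ennreal (p u i l y) \<longrightarrow> 0 < p u j l y"
      using kl_finite[OF *(2) i_lt *(3) *(1), THEN conjunct1] AE_space
    proof eventually_elim
      case (elim y)
      then show ?case using p_nonneg[OF *(2,3,1), of y] by (auto simp: less_le)
    qed
    then have "AE y in distr P mu (Z (Suc k) l u). 0 < p u j l y"
      unfolding Z_distr[of "Suc k" l u, OF _ *(1,2), simplified]
      by (subst AE_density) (auto simp: less_le)
    from AE_distrD[OF _ this] Z_meas * show ?thesis by simp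
  qed
  then have "AE w in P. l < L \<and> u < M \<and> j < M \<longrightarrow> 0 < p u j l (Z (Suc k) l u w)" for k l u j
    by (cases "l < L \<and> u < M \<and> j < M") auto
  then show ?thesis unfolding regular_def by (simp add: AE_all_countable)
qed

lemma lik_pos:
  assumes "regular w" "l < L" "j < M"
  shows "0 < lik p l (H l n w) j"
  using assms action_less[of l] by (induction n) (auto simp: lik_0 lik_Suc regular_def)

definition ratio :: "nat \<Rightarrow> nat \<Rightarrow> nat \<Rightarrow> 'a \<Rightarrow> real" where
  "ratio l j n w = lik p l (H l n w) j / lik p l (H l n w) i"

lemma ratio_nonneg: "l < L \<Longrightarrow> j < M \<Longrightarrow> w \<in> space P \<Longrightarrow> 0 \<le> ratio l j n w"
  using lik_nonneg i_lt by (simp add: ratio_def)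

lemma ratio_0: "ratio l j 0 w = 1"
  by (simp add: ratio_def lik_0)

lemma ratio_Suc: "ratio l j (Suc n) w = ratio l j n w *
    (p (action l n w) j l (obs l n w) / p (action l n w) i l (obs l n w))"
  by (simp add: ratio_def lik_Suc)

lemma measurable_ratio: "l < L \<Longrightarrow> j < M \<Longrightarrow> ratio l j n \<in> borel_measurable (alg (past_idx l n))"
  unfolding ratio_def[abs_def] by (intro borel_measurable_divide measurable_lik i_lt)

lemma measurable_ratio_P: "l < L \<Longrightarrow> j < M \<Longrightarrow> ratio l j n \<in> borel_measurable P"
  by (rule measurable_subalg_le[OF gen_events measurable_ratio past_idx_idx])

lemma measurable_guess_P: "l < L \<Longrightarrow> guess l n \<in> measurable P (count_space UNIV)"
  by (rule measurable_subalg_le[OF gen_events measurable_guess past_idx_idx])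

text \<open>The exponential weight compensates the mean contraction of the ratio. The guess at time
  \<open>n\<close> steers the next action, so its rate enters only at time
  \<open>n + 1\<close>.\<close>

definition mart :: "nat \<Rightarrow> nat \<Rightarrow> real \<Rightarrow> (nat \<Rightarrow> real) \<Rightarrow> nat \<Rightarrow> 'a \<Rightarrow> real" where
  "mart l j t b n w = ratio l j n w powr t * exp (\<Sum>m<n. b (guess l m w))"

lemma mart_nonneg: "0 \<le> mart l j t b n w"
  by (simp add: mart_def)

lemma measurable_mart:
  assumes l: "l < L" and j: "j < M" and "m \<le> n"
  shows "mart l j t b m \<in> borel_measurable (alg (past_idx l n))"
proof -
  have [measurable]: "ratio l j m \<in> borel_measurable (alg (past_idx l n))"
    using past_idx_mono[OF \<open>m \<le> n\<close>] past_idx_idx[OF l]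
    by (intro measurable_subalg_mono[OF gen_events measurable_ratio[OF l j]])
  have "(\<lambda>w. b (guess l k w)) \<in> borel_measurable (alg (past_idx l n))" if "k \<in> {..<m}" for k
  proof -
    have "k \<le> n" using that \<open>m \<le> n\<close> by simp
    then have "guess l k \<in> measurable (alg (past_idx l n)) (count_space UNIV)"
      by (intro measurable_subalg_mono[OF gen_events measurable_guess[OF l] _ past_idx_idx[OF l]] past_idx_mono)
    then show ?thesis by (rule measurable_compose) simp
  qed
  then have [measurable]: "(\<lambda>w. \<Sum>k<m. b (guess l k w)) \<in> borel_measurable (alg (past_idx l n))"
    by (intro borel_measurable_sum) simp
  show ?thesis unfolding mart_def[abs_def] by measurable
qed

lemma measurable_mart_P: "l < L \<Longrightarrow> j < M \<Longrightarrow> mart l j t b n \<in> borel_measurable P"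
  by (rule measurable_subalg_le[OF gen_events measurable_mart[OF _ _ order_refl] past_idx_idx])

text \<open>Under the action law of guess \<open>k\<close> the power of the ratio shrinks in mean by
  a factor of at most \<open>exp (- b k)\<close>, which cancels the new weight. Testing against
  every \<open>G\<close> of the past replaces conditional expectation.\<close>

lemma mart_step:
  assumes l: "l < L" and j: "j < M" and t: "0 < t" "t \<le> 1"
    and b: "\<And>k. k < M \<Longrightarrow> (\<Sum>u<M. Qs l k u * chernoff_coeff mu (p u i l) (p u j l) t) \<le> exp (- b k)"
    and G: "G \<in> borel_measurable (alg (past_idx l n))"
  shows "(\<integral>\<^sup>+ w. ennreal (mart l j t b (Suc n) w) * G w \<partial>P) \<le> (\<integral>\<^sup>+ w. ennreal (mart l j t b n w) * G w \<partial>P)"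
proof -
  define f where "f u y = ennreal ((p u j l y / p u i l y) powr t)" for u y
  define X where "X w = ennreal (mart l j t b n w) * ennreal (exp (b (guess l n w))) * G w" for w
  have fm: "f u \<in> borel_measurable mu" if "u < M" for u
    unfolding f_def using p_meas[OF that j l] p_meas[OF that i_lt l] by measurable
  have X: "X \<in> borel_measurable (alg (past_idx l n))"
  proof -
    have [measurable]: "mart l j t b n \<in> borel_measurable (alg (past_idx l n))"
      by (intro measurable_mart l j order_refl)
    have "(\<lambda>w. exp (b (guess l n w))) \<in> borel_measurable (alg (past_idx l n))"
      by (rule measurable_compose[OF measurable_guess[OF l]]) simp
    note [measurable] = this G
    show ?thesis unfolding X_def by measurable
  qed
  have coeff: "(\<integral>\<^sup>+ y. f u y \<partial>density mu (\<lambda>y. ennreal (p u i l y)))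
      = ennreal (chernoff_coeff mu (p u i l) (p u j l) t)" if "u < M" for u
    unfolding f_def using that i_lt j l t
    by (intro density_pair.nn_integral_likelihood_ratio_powr density_pair)
  have "(\<integral>\<^sup>+ w. ennreal (mart l j t b (Suc n) w) * G w \<partial>P) = (\<integral>\<^sup>+ w. X w * f (action l n w) (obs l n w) \<partial>P)"
  proof (rule nn_integral_cong)
    fix w assume w: "w \<in> space P"
    have "mart l j t b (Suc n) w = mart l j t b n w * exp (b (guess l n w)) *
        ((p (action l n w) j l (obs l n w) / p (action l n w) i l (obs l n w)) powr t)"
      using ratio_nonneg[OF l j w, of n] p_nonneg[OF action_less[OF l] _ l obs_space[OF l w]] i_lt j
      by (simp add: mart_def ratio_Suc powr_mult exp_add del: times_divide_eq_right)
    then show "ennreal (mart l j t b (Suc n) w) * G w = X w * f (action l n w) (obs l n w)"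
      by (simp add: X_def f_def ennreal_mult mart_nonneg mult_ac)
  qed
  also have "\<dots> = (\<integral>\<^sup>+ w. X w * (\<Sum>u<M. ennreal (Qs l (guess l n w) u) *
      (\<integral>\<^sup>+ y. f u y \<partial>density mu (\<lambda>y. ennreal (p u i l y)))) \<partial>P)"
    by (rule nn_integral_step[OF l X fm])
  also have "\<dots> \<le> (\<integral>\<^sup>+ w. ennreal (mart l j t b n w) * G w \<partial>P)"
  proof (rule nn_integral_mono)
    fix w
    let ?k = "guess l n w"
    have nonneg: "0 \<le> Qs l ?k u * chernoff_coeff mu (p u i l) (p u j l) t" if "u < M" for u
      using density_pair.chernoff_coeff_nonneg[OF density_pair[OF that i_lt j l]] Q_nonneg[OF l guess_less that]
      by simp
    have "(\<Sum>u<M. ennreal (Qs l ?k u) * (\<integral>\<^sup>+ y. f u y \<partial>density mu (\<lambda>y. ennreal (p u i l y))))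
        = (\<Sum>u<M. ennreal (Qs l ?k u * chernoff_coeff mu (p u i l) (p u j l) t))"
      using l guess_less by (intro sum.cong refl) (simp add: coeff ennreal_mult' Q_nonneg)
    also have "\<dots> = ennreal (\<Sum>u<M. Qs l ?k u * chernoff_coeff mu (p u i l) (p u j l) t)"
      using nonneg by (intro sum_ennreal) auto
    also have "\<dots> \<le> ennreal (exp (- b ?k))"
      by (intro ennreal_leI b guess_less)
    finally have "X w * (\<Sum>u<M. ennreal (Qs l ?k u) * (\<integral>\<^sup>+ y. f u y \<partial>density mu (\<lambda>y. ennreal (p u i l y))))
        \<le> X w * ennreal (exp (- b ?k))" by (rule mult_left_mono) simp
    also have "\<dots> = ennreal (mart l j t b n w) * G w * (ennreal (exp (b ?k)) * ennreal (exp (- b ?k)))"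
      by (simp add: X_def mult_ac)
    also have "ennreal (exp (b ?k)) * ennreal (exp (- b ?k)) = 1"
      by (simp flip: ennreal_mult exp_add)
    finally show "X w * (\<Sum>u<M. ennreal (Qs l ?k u) * (\<integral>\<^sup>+ y. f u y \<partial>density mu (\<lambda>y. ennreal (p u i l y))))
        \<le> ennreal (mart l j t b n w) * G w" by simp
  qed
  finally show ?thesis .
qed

text \<open>Ville's inequality for a process that starts at 1. The event of no crossing up to
  \<open>n\<close> belongs to the past, so its indicator is an admissible \<open>G\<close> in
  \<open>mart_step\<close>.\<close>

lemma mart_maximal:
  assumes l: "l < L" and j: "j < M" and t: "0 < t" "t \<le> 1" and a: "0 < a"
    and b: "\<And>k. k < M \<Longrightarrow> (\<Sum>u<M. Qs l k u * chernoff_coeff mu (p u i l) (p u j l) t) \<le> exp (- b k)"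
  shows "prob {w \<in> space P. \<exists>n. a \<le> mart l j t b n w} \<le> 1 / a"
proof -
  let ?X = "\<lambda>n w. ennreal (mart l j t b n w)"
  have "ennreal a * emeasure P {w \<in> space P. \<exists>n. ennreal a \<le> ?X n w} \<le> (\<integral>\<^sup>+ w. ?X 0 w \<partial>P)"
  proof (rule ville_inequality)
    show "?X n \<in> borel_measurable P" for n using measurable_mart_P[OF l j] by measurable
    fix n
    have "{w \<in> space (alg (past_idx l n)). ?X m w < ennreal a} \<in> sets (alg (past_idx l n))" if "m \<in> {..n}" for m
    proof -
      have [measurable]: "mart l j t b m \<in> borel_measurable (alg (past_idx l n))"
        using that by (intro measurable_mart l j) auto
      show ?thesis by measurable
    qed
    then have "{w \<in> space (alg (past_idx l n)). \<forall>m\<in>{..n}. ?X m w < ennreal a} \<in> sets (alg (past_idx l n))"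
      by (rule sets.sets_Collect_finite_All') auto
    then have "{w \<in> space P. \<forall>m\<le>n. ?X m w < ennreal a} \<in> sets (alg (past_idx l n))"
      by (simp only: space_subalg Ball_def atMost_iff)
    then show "(\<integral>\<^sup>+ w. ?X (Suc n) w * indicator {w \<in> space P. \<forall>m\<le>n. ?X m w < ennreal a} w \<partial>P)
        \<le> (\<integral>\<^sup>+ w. ?X n w * indicator {w \<in> space P. \<forall>m\<le>n. ?X m w < ennreal a} w \<partial>P)"
      by (intro mart_step l j t b borel_measurable_indicator)
  qed
  moreover have "(\<integral>\<^sup>+ w. ?X 0 w \<partial>P) = 1"
    by (simp add: mart_def ratio_0 emeasure_space_1)
  ultimately have "ennreal (a * prob {w \<in> space P. \<exists>n. a \<le> mart l j t b n w}) \<le> 1"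
    using a by (simp add: emeasure_eq_measure ennreal_mult' mart_nonneg)
  then have "a * prob {w \<in> space P. \<exists>n. a \<le> mart l j t b n w} \<le> 1"
    by (simp add: ennreal_le_1)
  then show ?thesis using a by (simp add: field_simps)
qed

section \<open>Drift of the Chernoff actions and choice of exponents\<close>

text \<open>\<open>Qs l j\<close> attains the max-min value, and the average for a single rival is
  at least the minimum.\<close>

lemma drift_ge:
  assumes l: "l < L" and j: "j < M" and j': "j' < M" "j' \<noteq> j"
  shows "vval mu p M l j \<le> (\<Sum>u<M. Qs l j u * kl mu (p u j l) (p u j' l))"
proof -
  have "chernoff_obj mu p M l j (Qs l j) \<le> (\<Sum>u<M. Qs l j u * kl mu (p u j l) (p u j' l))"
    unfolding chernoff_obj_def using j' by (intro Min_le) auto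
  then show ?thesis using Qs_opt[OF l j] by simp
qed

lemma chernoff_obj_ge:
  assumes "\<And>j'. j' < M \<Longrightarrow> j' \<noteq> j \<Longrightarrow> a \<le> (\<Sum>u<M. q u * kl mu (p u j l) (p u j' l))"
  shows "a \<le> chernoff_obj mu p M l j q"
proof -
  have "\<exists>j'<M. j' \<noteq> j" using M2 by (cases "j = 0") (auto intro: exI[of _ 1] exI[of _ 0])
  then show ?thesis unfolding chernoff_obj_def using assms
    by (subst Min_ge_iff) auto
qed

lemma vval_pos:
  assumes l: "l < L" and j: "j < M"
  shows "0 < vval mu p M l j"
proof -
  \<comment> \<open>The uniform law gives weight to the action that separates \<open>j\<close> from
    each rival, so all its averaged divergences are positive.\<close>
  define q where "q u = 1 / real M" for u :: nat
  define S where "S j' = (\<Sum>u<M. q u * kl mu (p u j l) (p u j' l))" for j'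
  have q: "q \<in> action_pmfs M" using M_pos by (simp add: action_pmfs_def q_def)
  have kl0: "0 \<le> kl mu (p u j l) (p u j' l)" if "u < M" "j' < M" for u j'
    using density_pair.kl_nonneg[OF density_pair[OF that(1) j that(2) l]] .
  obtain j0 where j0: "j0 < M" "j0 \<noteq> j"
    using M2 by (cases "j = 0") (auto intro: that[of 1] that[of 0])
  have S_pos: "0 < S j'" if j': "j' < M" "j' \<noteq> j" for j'
  proof -
    obtain u where "u < M" "0 < kl mu (p u j l) (p u j' l)" using kl_pos[OF j j'(1) l] j' by auto
    then show ?thesis unfolding S_def using kl0 j' M_pos
      by (intro sum_pos2[of _ u]) (auto simp: q_def)
  qed
  define a where "a = Min (S ` {j'. j' < M \<and> j' \<noteq> j})"
  have "0 < a" unfolding a_def using S_pos j0 by (subst Min_gr_iff) auto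
  also have "a \<le> chernoff_obj mu p M l j q"
    by (intro chernoff_obj_ge) (auto simp: a_def S_def intro!: Min_le)
  \<comment> \<open>A supremum of reals dominates its members only if the set is bounded above; a
    single rival \<open>j0\<close> supplies the bound, all weights being at most one.\<close>
  also have "\<dots> \<le> vval mu p M l j" unfolding vval_def
  proof (rule cSUP_upper[OF q], rule bdd_aboveI2)
    fix q' assume q': "q' \<in> action_pmfs M"
    have "chernoff_obj mu p M l j q' \<le> (\<Sum>u<M. q' u * kl mu (p u j l) (p u j0 l))"
      unfolding chernoff_obj_def using j0 by (intro Min_le) auto
    also have "\<dots> \<le> (\<Sum>u<M. 1 * kl mu (p u j l) (p u j0 l))"
    proof (intro sum_mono mult_right_mono kl0 j0)
      fix u assume u: "u \<in> {..<M}"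
      have "q' u \<le> (\<Sum>u<M. q' u)" using q' u by (intro member_le_sum) (auto simp: action_pmfs_def)
      then show "q' u \<le> 1" using q' by (simp add: action_pmfs_def)
    qed simp
    finally show "chernoff_obj mu p M l j q' \<le> (\<Sum>u<M. 1 * kl mu (p u j l) (p u j0 l))" .
  qed
  finally show ?thesis .
qed

text \<open>The averaged coefficient has slope minus the averaged divergence at exponent 0, so for a
  suitable small \<open>t\<close> it lies below \<open>1 - t * d\<close>, hence below
  \<open>exp (- (t * d))\<close>.\<close>

lemma exists_exponent:
  assumes l: "l < L" and j: "j < M" "j' < M"
    and d: "d < (\<Sum>u<M. q u * kl mu (p u j l) (p u j' l))" and q: "(\<Sum>u<M. q u) = 1"
  obtains t where "0 < t" "t < 1" "(\<Sum>u<M. q u * chernoff_coeff mu (p u j l) (p u j' l) t) \<le> exp (- (t * d))"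
proof -
  let ?C = "\<lambda>u t. chernoff_coeff mu (p u j l) (p u j' l) t"
  have "(\<lambda>n. \<Sum>u<M. q u * ((1 - ?C u (1 / real (Suc n))) * real (Suc n)))
      \<longlonglongrightarrow> (\<Sum>u<M. q u * kl mu (p u j l) (p u j' l))"
    using j l by (intro tendsto_intros density_pair.chernoff_coeff_slope density_pair) auto
  \<comment> \<open>Excluding \<open>n = 0\<close> keeps \<open>t\<close> strictly below one, as
    \<open>chernoff_coeff_swap\<close> requires.\<close>
  from order_tendstoD(1)[OF this d] eventually_gt_at_top[of 0]
  have "eventually (\<lambda>n. d < (\<Sum>u<M. q u * ((1 - ?C u (1 / real (Suc n))) * real (Suc n))) \<and> 0 < n) sequentially"
    by eventually_elim auto
  then obtain n where n: "d < (\<Sum>u<M. q u * ((1 - ?C u (1 / real (Suc n))) * real (Suc n)))" "0 < n"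
    by (auto simp: eventually_sequentially)
  define t where "t = 1 / real (Suc n)"
  have "(\<Sum>u<M. q u * ((1 - ?C u t) * real (Suc n))) = (1 - (\<Sum>u<M. q u * ?C u t)) / t"
    by (simp add: t_def right_diff_distrib left_diff_distrib sum_subtractf sum_distrib_right q
        del: of_nat_Suc flip: mult.assoc)
       (simp flip: sum_distrib_right add: q)
  with n(1) have "d < (1 - (\<Sum>u<M. q u * ?C u t)) / t" by (simp add: t_def)
  moreover have t: "0 < t" "t < 1" using n(2) by (auto simp: t_def)
  ultimately have "(\<Sum>u<M. q u * ?C u t) \<le> 1 + - (t * d)" by (simp add: field_simps)
  also have "\<dots> \<le> exp (- (t * d))" by (rule exp_ge_add_one_self)
  finally show ?thesis using t by (intro that)
qed

lemma sum_coeff_le_one: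
  assumes "l < L" "j < M" "k < M" "0 < t" "t \<le> 1"
  shows "(\<Sum>u<M. Qs l k u * chernoff_coeff mu (p u i l) (p u j l) t) \<le> 1"
proof -
  have "(\<Sum>u<M. Qs l k u * chernoff_coeff mu (p u i l) (p u j l) t) \<le> (\<Sum>u<M. Qs l k u * 1)"
    using assms i_lt by (intro sum_mono mult_left_mono density_pair.chernoff_coeff_le_one density_pair Q_nonneg) auto
  then show ?thesis using Q_sum assms by simp
qed

section \<open>Tail bounds for wrong guesses and for the likelihood ratio\<close>

definition visits :: "nat \<Rightarrow> nat \<Rightarrow> nat \<Rightarrow> 'a \<Rightarrow> real" where
  "visits l k n w = (\<Sum>m<n. of_bool (guess l m w = k))"

lemma visits_Suc: "visits l k (Suc n) w = visits l k n w + of_bool (guess l n w = k)"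
  by (simp add: visits_def)

text \<open>Take for \<open>m\<close> the last visit before \<open>n\<close>; all other visits
  precede it. At that time the guess is known to be \<open>k\<close>, which is what the lower bound
  on the likelihood ratio needs.\<close>

lemma visits_last:
  assumes "0 < x" "x \<le> visits l k n w"
  shows "\<exists>m<n. guess l m w = k \<and> x - 1 \<le> visits l k m w"
  using assms(2)
proof (induction n)
  case 0
  with assms(1) show ?case by (simp add: visits_def)
next
  case (Suc n)
  then show ?case
    by (cases "guess l n w = k") (auto simp: visits_Suc less_Suc_eq)
qed

lemma sum_visits: "(\<Sum>k<M. visits l k n w) = real n"
proof -
  have "(\<Sum>k<M. visits l k n w) = (\<Sum>m<n. \<Sum>k<M. of_bool (guess l m w = k))"
    unfolding visits_def by (rule sum.swap)
  also have "\<dots> = (\<Sum>m<n. 1)"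
    using guess_less by (intro sum.cong refl) (simp add: of_bool_def)
  finally show ?thesis by simp
qed

lemma mart_single:
  "mart l j t (\<lambda>k'. if k' = k then \<beta> else 0) n w = ratio l j n w powr t * exp (\<beta> * visits l k n w)"
proof -
  have "(\<Sum>m<n. if guess l m w = k then \<beta> else 0) = \<beta> * visits l k n w"
    unfolding visits_def sum_distrib_left by (intro sum.cong) auto
  then show ?thesis by (simp add: mart_def)
qed

lemma measurable_visits: "l < L \<Longrightarrow> visits l k n \<in> borel_measurable P"
  unfolding visits_def[abs_def] using measurable_guess_P[of l]
  by (intro borel_measurable_sum) (auto intro!: measurable_compose[OF measurable_guess_P])

text \<open>Whenever the wrong hypothesis \<open>j\<close> is the local guess, the likelihood ratio of \<open>j\<close> against
  \<open>i\<close> is at least one, although it contracts in mean at each such step.  The strict contraction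
  comes from the symmetry of the Chernoff coefficient: the action law of \<open>j\<close> is only known to
  separate \<open>j\<close> from \<open>i\<close> in the divergence of \<open>j\<close> from \<open>i\<close>.\<close>
lemma wrong_visits_tail:
  assumes l: "l < L" and j: "j < M" "j \<noteq> i"
  obtains \<beta> where "0 < \<beta>" "\<And>n x. prob {w \<in> space P. x \<le> visits l j n w} \<le> exp (- \<beta> * (x - 1))"
proof -
  let ?v = "vval mu p M l j"
  have v: "0 < ?v" by (rule vval_pos[OF l j(1)])
  have "?v / 2 < ?v" using v by simp
  also have "?v \<le> (\<Sum>u<M. Qs l j u * kl mu (p u j l) (p u i l))" using drift_ge[OF l j(1) i_lt] j by simp
  finally have lt: "?v / 2 < (\<Sum>u<M. Qs l j u * kl mu (p u j l) (p u i l))" .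
  obtain s where s: "0 < s" "s < 1"
    "(\<Sum>u<M. Qs l j u * chernoff_coeff mu (p u j l) (p u i l) s) \<le> exp (- (s * (?v / 2)))"
    by (rule exists_exponent[OF l j(1) i_lt lt Q_sum[OF l j(1)]])
  define \<beta> where "\<beta> = s * (?v / 2)"
  \<comment> \<open>The complementary exponent makes \<open>chernoff_coeff_swap\<close> applicable:
    at guess \<open>j\<close> the power of the ratio of \<open>j\<close> against \<open>i\<close>
    then shrinks in mean by \<open>exp (- \<beta>)\<close>.\<close>
  define t where "t = 1 - s"
  have t: "0 < t" "t \<le> 1" using s by (auto simp: t_def)
  have \<beta>: "0 < \<beta>" using s v by (simp add: \<beta>_def)
  let ?b = "\<lambda>k'. if k' = j then \<beta> else 0"
  have b: "(\<Sum>u<M. Qs l k u * chernoff_coeff mu (p u i l) (p u j l) t) \<le> exp (- ?b k)" if k: "k < M" for k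
  proof (cases "k = j")
    case True
    have "(\<Sum>u<M. Qs l j u * chernoff_coeff mu (p u i l) (p u j l) t)
        = (\<Sum>u<M. Qs l j u * chernoff_coeff mu (p u j l) (p u i l) s)"
      unfolding t_def using s p_nonneg i_lt j l
      by (intro sum.cong refl arg_cong2[where f=times] chernoff_coeff_swap) auto
    then show ?thesis using True s(3) by (simp add: \<beta>_def)
  qed (use sum_coeff_le_one[OF l j(1) k t] in simp)
  have "prob {w \<in> space P. x \<le> visits l j n w} \<le> exp (- \<beta> * (x - 1))" for n x
  proof (cases "0 < x")
    case True
    \<comment> \<open>The shift \<open>x - 1\<close> comes from \<open>visits_last\<close>: the
      visit at time \<open>m\<close> is itself not counted in \<open>visits l j m w\<close>.\<close>
    let ?B = "{w \<in> space P. \<exists>m. exp (\<beta> * (x - 1)) \<le> mart l j t ?b m w}"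
    have [measurable]: "mart l j t ?b m \<in> borel_measurable P" for m by (rule measurable_mart_P[OF l j(1)])
    have "prob {w \<in> space P. x \<le> visits l j n w} \<le> prob ?B"
    proof (rule finite_measure_mono_AE)
      show "AE w in P. w \<in> {w \<in> space P. x \<le> visits l j n w} \<longrightarrow> w \<in> ?B"
        using AE_regular
      proof eventually_elim
        case (elim w)
        show ?case
        proof
          assume w: "w \<in> {w \<in> space P. x \<le> visits l j n w}"
          then obtain m where m: "guess l m w = j" "x - 1 \<le> visits l j m w"
            using visits_last[OF True, of l j n w] by auto
          have "post p M l (H l m w) i \<le> post p M l (H l m w) j"
            using argmax_idx_ge[OF M_pos i_lt, of "post p M l (H l m w)"] m(1) by (simp add: guess_def)
          moreover have "0 < (\<Sum>k<M. lik p l (H l m w) k)"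
            using M_pos by (intro sum_pos lik_pos elim l) auto
          ultimately have "1 \<le> ratio l j m w"
            using lik_pos[OF elim l i_lt, of m] by (simp add: ratio_def post_def divide_le_cancel)
          then have "1 \<le> ratio l j m w powr t" using t by (intro ge_one_powr_ge_zero) auto
          moreover have "exp (\<beta> * (x - 1)) \<le> exp (\<beta> * visits l j m w)" using m \<beta> by simp
          ultimately have "1 * exp (\<beta> * (x - 1)) \<le> mart l j t ?b m w"
            unfolding mart_single by (intro mult_mono) auto
          then show "w \<in> ?B" using w by auto
        qed
      qed
    qed measurable
    also have "\<dots> \<le> 1 / exp (\<beta> * (x - 1))" by (intro mart_maximal l j t b) auto
    finally show ?thesis by (simp add: exp_minus inverse_eq_divide)
  next
    \<comment> \<open>For \<open>x \<le> 0\<close> the claimed bound exceeds one.\<close>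
    case False
    then have "0 \<le> \<beta> * (1 - x)" using \<beta> by simp
    then have "1 \<le> exp (- \<beta> * (x - 1))" by (simp add: algebra_simps)
    then show ?thesis by (rule order_trans[OF prob_le_1])
  qed
  with \<beta> show ?thesis by (rule that)
qed

text \<open>A wrong guess takes up a fraction \<open>\<eta>\<close> of the steps only with
  exponentially small probability. Otherwise most steps use the action law of \<open>i\<close>, and
  a large ratio would lift the weighted process to a level that Ville's inequality makes
  exponentially unlikely.\<close>

lemma ratio_deviation:
  assumes l: "l < L" and j: "j < M" "j \<noteq> i" and \<delta>: "0 < \<delta>" "\<delta> < 1"
  shows "exp_decay (\<lambda>n. prob {w \<in> space P. exp (- (1 - \<delta>) * vval mu p M l i * real n) < ratio l j n w})"
proof -
  let ?v = "vval mu p M l i"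
  have v: "0 < ?v" by (rule vval_pos[OF l i_lt])
  \<comment> \<open>Half of the slack \<open>\<delta>\<close> is spent on the exponent, a quarter on
    wrong guesses and a quarter on the level in \<open>?D\<close>.\<close>
  have "(1 - \<delta> / 2) * ?v < ?v" using v \<delta> by simp
  also have "?v \<le> (\<Sum>u<M. Qs l i u * kl mu (p u i l) (p u j l))" using drift_ge[OF l i_lt j] .
  finally have lt: "(1 - \<delta> / 2) * ?v < (\<Sum>u<M. Qs l i u * kl mu (p u i l) (p u j l))" .
  obtain t where t: "0 < t" "t < 1"
    "(\<Sum>u<M. Qs l i u * chernoff_coeff mu (p u i l) (p u j l) t) \<le> exp (- (t * ((1 - \<delta> / 2) * ?v)))"
    by (rule exists_exponent[OF l i_lt j(1) lt Q_sum[OF l i_lt]])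
  define \<gamma> where "\<gamma> = t * ((1 - \<delta> / 2) * ?v)"
  have \<gamma>: "0 < \<gamma>" using t v \<delta> by (simp add: \<gamma>_def)
  let ?b = "\<lambda>k'. if k' = i then \<gamma> else 0"
  have b: "(\<Sum>u<M. Qs l k u * chernoff_coeff mu (p u i l) (p u j l) t) \<le> exp (- ?b k)" if k: "k < M" for k
    using t(3) sum_coeff_le_one[OF l j(1) k, of t] t by (simp add: \<gamma>_def)
  \<comment> \<open>With fewer than \<open>M\<close> wrong hypotheses, their guesses together take
    up at most the fraction \<open>\<delta> / 4\<close> of the steps.\<close>
  define \<eta> where "\<eta> = \<delta> / (4 * real M)"
  have \<eta>: "0 < \<eta>" using \<delta> M_pos by (simp add: \<eta>_def)
  let ?V = "\<lambda>k n. {w \<in> space P. \<eta> * real n \<le> visits l k n w}"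
  let ?D = "\<lambda>n. {w \<in> space P. \<exists>m. exp (t * (\<delta> / 4) * ?v * real n) \<le> mart l j t ?b m w}"
  have [measurable]: "mart l j t ?b m \<in> borel_measurable P" for m by (rule measurable_mart_P[OF l j(1)])
  have [measurable]: "visits l k n \<in> borel_measurable P" for k n by (rule measurable_visits[OF l])
  have "exp_decay (\<lambda>n. prob (?V k n))" if k: "k \<in> {..<M} - {i}" for k
  proof -
    obtain \<beta> where \<beta>: "0 < \<beta>" "\<And>n x. prob {w \<in> space P. x \<le> visits l k n w} \<le> exp (- \<beta> * (x - 1))"
      using wrong_visits_tail[OF l, of k] k by auto
    show ?thesis
    proof (rule exp_decayI[of "exp \<beta>" "\<beta> * \<eta>"])
      show "prob (?V k n) \<le> exp \<beta> * exp (- (\<beta> * \<eta>) * real n)" for n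
        using \<beta>(2)[of "\<eta> * real n" n] by (simp add: algebra_simps flip: exp_add)
    qed (use \<beta> \<eta> in auto)
  qed
  then have "exp_decay (\<lambda>n. \<Sum>k\<in>{..<M} - {i}. prob (?V k n))" by (intro exp_decay_sum) auto
  moreover have "exp_decay (\<lambda>n. prob (?D n))"
  proof (rule exp_decayI[of 1 "t * (\<delta> / 4) * ?v"])
    show "prob (?D n) \<le> 1 * exp (- (t * (\<delta> / 4) * ?v) * real n)" for n
    proof -
      have "prob (?D n) \<le> 1 / exp (t * (\<delta> / 4) * ?v * real n)"
        using t by (intro mart_maximal l j b) auto
      then show ?thesis by (simp add: exp_minus inverse_eq_divide)
    qed
  qed (use t \<delta> v in auto)
  ultimately have "exp_decay (\<lambda>n. (\<Sum>k\<in>{..<M} - {i}. prob (?V k n)) + prob (?D n))"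
    by (rule exp_decay_add)
  then show ?thesis
  proof (rule exp_decay_mono)
    fix n
    let ?E = "{w \<in> space P. exp (- (1 - \<delta>) * ?v * real n) < ratio l j n w}"
    have "?E \<subseteq> (\<Union>k\<in>{..<M} - {i}. ?V k n) \<union> ?D n"
    proof
      fix w assume w: "w \<in> ?E"
      show "w \<in> (\<Union>k\<in>{..<M} - {i}. ?V k n) \<union> ?D n"
      proof (rule ccontr)
        assume not: "w \<notin> (\<Union>k\<in>{..<M} - {i}. ?V k n) \<union> ?D n"
        have "real n = visits l i n w + (\<Sum>k\<in>{..<M} - {i}. visits l k n w)"
          using i_lt by (subst sum_visits[symmetric, of n l w], subst sum.remove[of _ i]) auto
        also have "(\<Sum>k\<in>{..<M} - {i}. visits l k n w) \<le> (\<Sum>k\<in>{..<M} - {i}. \<eta> * real n)"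
          using not w by (intro sum_mono) (auto simp: not_le less_imp_le)
        also have "\<dots> \<le> (\<Sum>k\<in>{..<M}. \<eta> * real n)"
          using \<eta> by (intro sum_mono2) auto
        also have "\<dots> = \<delta> / 4 * real n" using M_pos by (simp add: \<eta>_def)
        finally have vis: "(1 - \<delta> / 4) * real n \<le> visits l i n w" by (simp add: algebra_simps)
        have "t * (\<delta> / 4) * ?v * real n \<le> t * (- (1 - \<delta>) * ?v * real n) + \<gamma> * ((1 - \<delta> / 4) * real n)"
        proof -
          \<comment> \<open>The difference
            \<open>(1 - \<delta> / 2) * (1 - \<delta> / 4) - (1 - \<delta>)\<close> exceeds
            \<open>\<delta> / 4\<close> by \<open>\<delta> * \<delta> / 8\<close>.\<close>
          have "0 \<le> t * ?v * real n * (\<delta> * \<delta> / 8)" using t v by simp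
          also have "\<dots> = t * (- (1 - \<delta>) * ?v * real n) + \<gamma> * ((1 - \<delta> / 4) * real n) - t * (\<delta> / 4) * ?v * real n"
            by (simp add: \<gamma>_def field_simps)
          finally show ?thesis by simp
        qed
        also have "\<dots> \<le> t * (- (1 - \<delta>) * ?v * real n) + \<gamma> * visits l i n w"
          using vis \<gamma> by simp
        finally have "exp (t * (\<delta> / 4) * ?v * real n)
            \<le> exp (- (1 - \<delta>) * ?v * real n) powr t * exp (\<gamma> * visits l i n w)"
          by (simp add: powr_def mult_ac flip: exp_add)
        also have "\<dots> \<le> mart l j t ?b n w"
          unfolding mart_single using w t by (intro mult_right_mono powr_mono2) auto
        finally show False using not w by auto
      qed
    qed
    then have "prob ?E \<le> prob ((\<Union>k\<in>{..<M} - {i}. ?V k n) \<union> ?D n)"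
      by (intro finite_measure_mono) auto
    also have "\<dots> \<le> prob (\<Union>k\<in>{..<M} - {i}. ?V k n) + prob (?D n)"
      by (intro measure_Un_le) auto
    also have "prob (\<Union>k\<in>{..<M} - {i}. ?V k n) \<le> (\<Sum>k\<in>{..<M} - {i}. prob (?V k n))"
      by (intro finite_measure_subadditive_finite) auto
    finally show "prob ?E \<le> (\<Sum>k\<in>{..<M} - {i}. prob (?V k n)) + prob (?D n)" by simp
  qed
qed

text \<open>Outside this event every sensor has suppressed all rivals of \<open>i\<close> at nearly
  the optimal rate. The event does not depend on \<open>c\<close>, so one bound on its probability
  serves all costs.\<close>

definition bad :: "real \<Rightarrow> nat \<Rightarrow> 'a set" where
  "bad \<delta> n = (\<Union>(l, j)\<in>{..<L} \<times> ({..<M} - {i}).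
     {w \<in> space P. exp (- (1 - \<delta>) * vval mu p M l i * real n) < ratio l j n w})"

lemma bad_sets: "bad \<delta> n \<in> sets P"
  unfolding bad_def using measurable_ratio_P by (intro sets.finite_UN) auto

lemma bad_decay:
  assumes "0 < \<delta>" "\<delta> < 1"
  shows "exp_decay (\<lambda>n. prob (bad \<delta> n))"
proof -
  let ?E = "\<lambda>n (l, j). {w \<in> space P. exp (- (1 - \<delta>) * vval mu p M l i * real n) < ratio l j n w}"
  have "exp_decay (\<lambda>n. \<Sum>lj\<in>{..<L} \<times> ({..<M} - {i}). prob (?E n lj))"
    using assms by (intro exp_decay_sum) (auto intro!: ratio_deviation[of _ _ \<delta>, simplified])
  then show ?thesis
    by (rule exp_decay_mono) 
       (auto simp: bad_def intro!: finite_measure_subadditive_finite borel_measurable_less measurable_ratio_P)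
qed

end

section \<open>Auxiliary facts on powers and on the stopping rule\<close>

text \<open>This moves the additive constant of a moment bound into the base. The factor
  \<open>(y + C) powr (r - 1)\<close> is at least both \<open>y powr (r - 1)\<close> and 1, and
  multiplied by \<open>y + C\<close> it gives the right-hand side.\<close>

lemma powr_add_le:
  fixes y C r :: real
  assumes "1 \<le> y" "0 \<le> C" "1 \<le> r"
  shows "y powr r + C \<le> (y + C) powr r"
proof -
  have "1 \<le> y powr (r - 1)" using assms by (intro ge_one_powr_ge_zero) auto
  also have "\<dots> \<le> (y + C) powr (r - 1)" using assms by (intro powr_mono2) auto
  finally have ge: "1 \<le> (y + C) powr (r - 1)" .
  have "y powr r + C \<le> y * (y + C) powr (r - 1) + C * (y + C) powr (r - 1)"
  proof (rule add_mono)
    have "y powr r = y * y powr (r - 1)" using assms by (simp add: powr_diff)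
    also have "\<dots> \<le> y * (y + C) powr (r - 1)" using assms by (intro mult_left_mono powr_mono2) auto
    finally show "y powr r \<le> y * (y + C) powr (r - 1)" .
    show "C \<le> C * (y + C) powr (r - 1)" using ge assms(2) by (simp add: mult_le_cancel_left1)
  qed
  also have "\<dots> = (y + C) * (y + C) powr (r - 1)" by (simp add: distrib_right)
  also have "\<dots> = (y + C) powr r" using assms by (simp add: powr_diff)
  finally show ?thesis .
qed

lemma summable_powr_exp:
  fixes r b :: real
  assumes "0 < b"
  shows "summable (\<lambda>n. real (Suc n) powr r * exp (- b * real n))"
proof (rule summable_comparison_test_bigo)
  show "summable (\<lambda>n. norm (inverse (real n ^ 2)))" using inverse_power_summable[of 2] by simp
  show "(\<lambda>n. real (Suc n) powr r * exp (- b * real n)) \<in> O(\<lambda>n. inverse (real n ^ 2))"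
    using assms by real_asymp
qed

lemma filterlim_abs_ln_at_right_0: "filterlim (\<lambda>c::real. \<bar>ln c\<bar>) at_top (at_right 0)"
  by real_asymp

lemma enat_powr_one: "enat_powr n 1 = ennreal_of_enat n"
  by (cases n) (auto simp: enat_powr_def ennreal_of_nat_eq_real_of_nat)

lemma dct_N_le:
  assumes "dct_agree mu p M L Qs Z U c w n k"
  shows "dct_N mu p M L Qs Z U c w \<le> enat n"
proof -
  have "(LEAST n. \<exists>k. dct_agree mu p M L Qs Z U c w n k) \<le> n"
    using assms by (intro Least_le) blast
  then show ?thesis using assms unfolding dct_N_def by auto
qed

text \<open>The \<open>THE\<close> is well defined because the last decision of any one sensor fixes
  the agreed hypothesis; \<open>1 \<le> L\<close> provides that sensor.\<close>

lemma dct_hat_agree: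
  assumes "1 \<le> L" "dct_N mu p M L Qs Z U c w \<noteq> \<infinity>"
  shows "\<exists>n. dct_agree mu p M L Qs Z U c w n (dct_hat mu p M L Qs Z U c w)"
proof -
  have ex: "\<exists>n k. dct_agree mu p M L Qs Z U c w n k"
    using assms(2) unfolding dct_N_def by (auto split: if_splits)
  define n where "n = (LEAST n. \<exists>k. dct_agree mu p M L Qs Z U c w n k)"
  have "\<exists>k. dct_agree mu p M L Qs Z U c w n k" unfolding n_def by (rule LeastI_ex) (rule ex)
  then obtain k where k: "dct_agree mu p M L Qs Z U c w n k" by blast
  have N: "dct_N mu p M L Qs Z U c w = enat n" using ex by (auto simp: dct_N_def n_def)
  have "dct_hat mu p M L Qs Z U c w = k"
    unfolding dct_hat_def N the_enat.simps
  proof (rule the_equality)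
    show "dct_agree mu p M L Qs Z U c w n k" by (rule k)
    fix k' assume "dct_agree mu p M L Qs Z U c w n k'"
    then have "Some k' = Some k" using k assms(1) unfolding dct_agree_def by (metis One_nat_def Suc_le_lessD)
    then show "k' = k" by simp
  qed
  with k show ?thesis by blast
qed

section \<open>The stopping time and its moments\<close>

context dct_model
begin

abbreviation "I0 \<equiv> Ival mu p M L i"
abbreviation "thr c \<equiv> dct_thr mu p M L c"
abbreviation "N c w \<equiv> dct_N mu p M L Qs Z U c w"

lemma sensors_nonempty: "{..<L} \<noteq> {}"
proof -
  have "0 \<in> {..<L}" using L1 by simp
  then show ?thesis by blast
qed

lemma Ival_pos: "j < M \<Longrightarrow> 0 < Ival mu p M L j"
  unfolding Ival_def using sensors_nonempty by (intro sum_pos vval_pos) auto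

text \<open>The thresholds and the suppression exponents are both proportional to
  \<open>vval mu p M l i\<close>, so the same time \<open>n\<close> is late enough for every
  sensor.\<close>

lemma agree_if_good:
  assumes w: "w \<in> space P" "regular w" and c: "0 < c" "c < 1" and \<delta>: "0 < \<delta>" "\<delta> < 1"
    and n: "\<bar>ln c\<bar> / ((1 - \<delta>) * I0) \<le> real n" and good: "w \<notin> bad \<delta> n"
  shows "dct_agree mu p M L Qs Z U c w n i"
  unfolding dct_agree_def
proof (intro conjI allI impI i_lt)
  fix l assume l: "l < L"
  let ?v = "vval mu p M l i" and ?h = "H l n w"
  define e where "e = exp (- (1 - \<delta>) * ?v * real n)"
  have v: "0 < ?v" by (rule vval_pos[OF l i_lt])
  have ln_pos: "0 < \<bar>ln c\<bar>" using c by simp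
  have I_pos: "0 < I0" by (rule Ival_pos[OF i_lt])
  have n': "\<bar>ln c\<bar> \<le> (1 - \<delta>) * I0 * real n" using n \<delta> I_pos by (simp add: field_simps)
  \<comment> \<open>A positive \<open>n\<close> makes \<open>e\<close> strictly less than one, so
    \<open>i\<close> is the unique maximiser of the posterior.\<close>
  have "0 < real n" using n' ln_pos by (cases n) auto
  then have "0 < (1 - \<delta>) * ?v * real n" using \<delta> v by simp
  moreover have e_eq: "e = exp (- ((1 - \<delta>) * ?v * real n))" by (simp only: e_def mult_minus_left)
  ultimately have e: "0 < e" "e < 1" by simp_all
  have thr: "exp (thr c i l) * e \<le> 1"
  proof -
    have "thr c i l = ?v * \<bar>ln c\<bar> / I0" by (simp add: dct_thr_def rho_def)
    also have "\<dots> \<le> ?v * ((1 - \<delta>) * I0 * real n) / I0"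
      using n' v I_pos by (intro divide_right_mono mult_left_mono) auto
    also have "\<dots> = (1 - \<delta>) * ?v * real n" using I_pos by simp
    finally show ?thesis by (simp add: e_eq flip: exp_add)
  qed
  have S: "0 < (\<Sum>k<M. lik p l ?h k)"
    using M_pos by (intro sum_pos lik_pos w l) auto
  have post: "post p M l ?h j \<le> e * post p M l ?h i" if j: "j < M" "j \<noteq> i" for j
  proof -
    have "ratio l j n w \<le> e" using good l j w(1) by (auto simp: bad_def e_def not_less)
    then have "lik p l ?h j \<le> e * lik p l ?h i"
      using lik_pos[OF w(2) l i_lt, of n] by (simp add: ratio_def field_simps)
    then show ?thesis using S by (simp add: post_def divide_right_mono)
  qed
  have post_i: "0 < post p M l ?h i" using S lik_pos[OF w(2) l i_lt] by (simp add: post_def)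
  have arg: "argmax_idx M (post p M l ?h) = i"
  proof (rule argmax_idx_eqI[OF i_lt])
    fix j assume "j < M" "j \<noteq> i"
    with post have "post p M l ?h j \<le> e * post p M l ?h i" by simp
    also have "\<dots> < 1 * post p M l ?h i" using e post_i by (intro mult_strict_right_mono) auto
    finally show "post p M l ?h j < post p M l ?h i" by simp
  qed
  have "\<exists>j. j < M \<and> j \<noteq> i" using M2 by (cases "i = 0") (auto intro: exI[of _ 1] exI[of _ 0])
  then have "Max {post p M l ?h j | j. j < M \<and> j \<noteq> i} \<in> {post p M l ?h j | j. j < M \<and> j \<noteq> i}"
    by (intro Max_in) auto
  then have "Max {post p M l ?h j | j. j < M \<and> j \<noteq> i} \<le> e * post p M l ?h i" using post by auto
  then have "exp (thr c i l) * Max {post p M l ?h j | j. j < M \<and> j \<noteq> i} \<le> exp (thr c i l) * (e * post p M l ?h i)"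
    by simp
  also have "\<dots> \<le> 1 * post p M l ?h i"
    unfolding mult.assoc[symmetric] using thr post_i by (intro mult_right_mono) auto
  finally have fires: "fires p M l (thr c) ?h" by (simp add: fires_def arg)
  then have "(GREATEST m. m \<le> n \<and> fires p M l (thr c) (hist p M Qs Z U l w m)) = n"
    by (intro Greatest_equality) (auto simp: H_def)
  with fires show "lastdec mu p M L Qs Z U c l w n = Some i"
    using arg by (auto simp: lastdec_def H_def)
qed

text \<open>Being bad at all times from \<open>n0\<close> on is contained in each later
  \<open>bad \<delta> n\<close>, and their probabilities tend to zero.\<close>

lemma AE_not_always_bad:
  assumes "0 < \<delta>" "\<delta> < 1"
  shows "AE w in P. \<exists>n\<ge>n0. w \<notin> bad \<delta> n"
proof -
  let ?B = "\<Inter>n\<in>{n0..}. bad \<delta> n"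
  have B: "?B \<in> sets P" using bad_sets by (intro sets.countable_INT') auto
  from bad_decay[OF assms] obtain K b where Kb: "0 \<le> K" "0 < b" "\<And>n. prob (bad \<delta> n) \<le> K * exp (- b * real n)"
    unfolding exp_decay_def by blast
  have "prob ?B \<le> 0"
  proof (rule LIMSEQ_le_const)
    show "(\<lambda>n. K * exp (- b * real n)) \<longlonglongrightarrow> 0" using Kb(2) by real_asymp
    show "\<exists>n1. \<forall>n\<ge>n1. prob ?B \<le> K * exp (- b * real n)"
    proof (intro exI allI impI)
      fix n assume "n0 \<le> n"
      then have "prob ?B \<le> prob (bad \<delta> n)" using bad_sets by (intro finite_measure_mono) auto
      also note Kb(3)
      finally show "prob ?B \<le> K * exp (- b * real n)" .
    qed
  qed
  then have "emeasure P ?B = 0" by (simp add: emeasure_eq_measure measure_le_0_iff)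
  then have "?B \<in> null_sets P" using B by (simp add: null_sets_def)
  from AE_not_in[OF this] show ?thesis by eventually_elim auto
qed

lemma AE_N_finite:
  assumes c: "0 < c" "c < 1"
  shows "AE w in P. N c w \<noteq> \<infinity>"
proof -
  obtain n0 :: nat where n0: "\<bar>ln c\<bar> / ((1 - 1/2) * I0) \<le> real n0" using real_arch_simple by blast
  have half: "0 < (1/2::real)" "(1/2::real) < 1" by auto
  show ?thesis
    using AE_regular AE_space AE_not_always_bad[OF half, of n0]
  proof eventually_elim
    case (elim w)
    then obtain n where n: "n0 \<le> n" "w \<notin> bad (1/2) n" by blast
    have "\<bar>ln c\<bar> / ((1 - 1/2) * I0) \<le> real n" using n0 n(1) by linarith
    then have "dct_agree mu p M L Qs Z U c w n i"
      using elim c n(2) half by (intro agree_if_good) auto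
    from dct_N_le[OF this] show ?case by (cases "N c w") auto
  qed
qed

text \<open>If the test stops at \<open>m + 1\<close> with \<open>m \<ge> A\<close>, it did not stop
  at \<open>m\<close>, so \<open>m\<close> was bad, and the single summand with index
  \<open>m\<close> already equals the left side.\<close>

lemma moment_pointwise:
  assumes w: "w \<in> space P" "regular w" "N c w \<noteq> \<infinity>" and c: "0 < c" "c < 1" and \<delta>: "0 < \<delta>" "\<delta> < 1"
    and r: "0 \<le> r" and A: "A = nat \<lceil>\<bar>ln c\<bar> / ((1 - \<delta>) * I0)\<rceil>"
  shows "enat_powr (N c w) r \<le> ennreal (real A powr r) + (\<Sum>n. ennreal (real (Suc n) powr r) * indicator (bad \<delta> n) w)"
proof -
  from w(3) obtain k where k: "N c w = enat k" by auto
  show ?thesis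
  proof (cases "k \<le> A")
    case True
    then have "real k powr r \<le> real A powr r" using r by (intro powr_mono2) auto
    then have "ennreal (real k powr r) \<le> ennreal (real A powr r)" by (rule ennreal_leI)
    then show ?thesis using k by (simp add: enat_powr_def add_increasing2)
  next
    case False
    then obtain m where m: "k = Suc m" "A \<le> m" by (cases k) auto
    have "w \<in> bad \<delta> m"
    proof (rule ccontr)
      assume "w \<notin> bad \<delta> m"
      moreover have "\<bar>ln c\<bar> / ((1 - \<delta>) * I0) \<le> real m" using m(2) A by linarith
      ultimately have "dct_agree mu p M L Qs Z U c w m i" using w c \<delta> by (intro agree_if_good) auto
      from dct_N_le[OF this] show False using k m by simp
    qed
    then have "ennreal (real k powr r) = (\<Sum>n\<in>{m}. ennreal (real (Suc n) powr r) * indicator (bad \<delta> n) w)"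
      using m by simp
    also have "\<dots> \<le> (\<Sum>n. ennreal (real (Suc n) powr r) * indicator (bad \<delta> n) w)"
      by (intro sum_le_suminf) auto
    finally show ?thesis using k by (simp add: enat_powr_def add_increasing)
  qed
qed

text \<open>The constant is the sum over \<open>n\<close> of (n+1)^r times the exponential bound on
  the bad events, the same for all \<open>c\<close>.\<close>

lemma moment_bound:
  assumes \<delta>: "0 < \<delta>" "\<delta> < 1" and r: "0 \<le> r"
  obtains C where "0 \<le> C" "\<And>c. 0 < c \<Longrightarrow> c < 1 \<Longrightarrow>
    (\<integral>\<^sup>+ w. enat_powr (N c w) r \<partial>P)
      \<le> ennreal (real (nat \<lceil>\<bar>ln c\<bar> / ((1 - \<delta>) * I0)\<rceil>) powr r + C)"
proof -
  from bad_decay[OF \<delta>] obtain K b where Kb: "0 \<le> K" "0 < b" "\<And>n. prob (bad \<delta> n) \<le> K * exp (- b * real n)"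
    unfolding exp_decay_def by blast
  define a where "a n = K * (real (Suc n) powr r * exp (- b * real n))" for n
  have a: "summable a" "\<And>n. 0 \<le> a n"
    unfolding a_def using Kb summable_powr_exp[of b r] by (auto intro!: summable_mult)
  have "(\<integral>\<^sup>+ w. enat_powr (N c w) r \<partial>P) \<le> ennreal (real (nat \<lceil>\<bar>ln c\<bar> / ((1 - \<delta>) * I0)\<rceil>) powr r + suminf a)"
    if c: "0 < c" "c < 1" for c
  proof -
    define A where "A = nat \<lceil>\<bar>ln c\<bar> / ((1 - \<delta>) * I0)\<rceil>"
    note [measurable] = bad_sets[of \<delta>]
    have "(\<integral>\<^sup>+ w. enat_powr (N c w) r \<partial>P)
        \<le> (\<integral>\<^sup>+ w. ennreal (real A powr r) + (\<Sum>n. ennreal (real (Suc n) powr r) * indicator (bad \<delta> n) w) \<partial>P)"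
      using AE_space AE_regular AE_N_finite[OF c]
      by (intro nn_integral_mono_AE, eventually_elim) (intro moment_pointwise c \<delta> r A_def)
    also have "\<dots> = ennreal (real A powr r) + (\<Sum>n. ennreal (real (Suc n) powr r) * emeasure P (bad \<delta> n))"
      by (subst nn_integral_add) (auto simp: nn_integral_suminf nn_integral_cmult emeasure_space_1)
    also have "(\<Sum>n. ennreal (real (Suc n) powr r) * emeasure P (bad \<delta> n)) \<le> (\<Sum>n. ennreal (a n))"
    proof (intro suminf_le)
      fix n
      have "real (Suc n) powr r * prob (bad \<delta> n) \<le> real (Suc n) powr r * (K * exp (- b * real n))"
        by (intro mult_left_mono Kb) auto
      then have "real (Suc n) powr r * prob (bad \<delta> n) \<le> a n" by (simp add: a_def mult_ac)
      then show "ennreal (real (Suc n) powr r) * emeasure P (bad \<delta> n) \<le> ennreal (a n)"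
        unfolding emeasure_eq_measure by (subst ennreal_mult[symmetric]) (auto intro: ennreal_leI)
    qed auto
    also have "\<dots> = ennreal (suminf a)" using a by (intro suminf_ennreal2) auto
    finally have "(\<integral>\<^sup>+ w. enat_powr (N c w) r \<partial>P) \<le> ennreal (real A powr r) + ennreal (suminf a)"
      by (auto intro: add_left_mono)
    then show ?thesis using a by (simp add: A_def suminf_nonneg)
  qed
  moreover have "0 \<le> suminf a" using a by (intro suminf_nonneg)
  ultimately show ?thesis using that by blast
qed

lemma moment_asymptotics:
  assumes r: "1 \<le> r" and \<epsilon>: "0 < \<epsilon>"
  shows "eventually (\<lambda>c. (\<integral>\<^sup>+ w. enat_powr (N c w) r \<partial>P)
            \<le> ennreal (((1 + \<epsilon>) * \<bar>ln c\<bar> / I0) powr r)) (at_right 0)"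
proof -
  \<comment> \<open>With this choice
    \<open>(1 + \<epsilon>) * (1 - \<delta>) = 1 + \<epsilon> / 2\<close>, so a positive gap
    \<open>g\<close> is left.\<close>
  define \<delta> where "\<delta> = \<epsilon> / (2 * (1 + \<epsilon>))"
  have \<delta>: "0 < \<delta>" "\<delta> < 1" using \<epsilon> by (auto simp: \<delta>_def field_simps)
  have gap: "1 / (1 - \<delta>) < 1 + \<epsilon>"
  proof -
    have "(1 + \<epsilon>) * (1 - \<delta>) = 1 + \<epsilon> / 2" using \<epsilon> by (simp add: \<delta>_def field_simps)
    then have "1 < (1 + \<epsilon>) * (1 - \<delta>)" using \<epsilon> by simp
    then show ?thesis using \<delta> by (simp add: field_simps)
  qed
  define g where "g = 1 + \<epsilon> - 1 / (1 - \<delta>)"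
  have g: "0 < g" using gap by (simp add: g_def)
  have I_pos: "0 < I0" by (rule Ival_pos[OF i_lt])
  obtain C where C: "0 \<le> C" "\<And>c. 0 < c \<Longrightarrow> c < 1 \<Longrightarrow> (\<integral>\<^sup>+ w. enat_powr (N c w) r \<partial>P)
      \<le> ennreal (real (nat \<lceil>\<bar>ln c\<bar> / ((1 - \<delta>) * I0)\<rceil>) powr r + C)"
    using moment_bound[OF \<delta>, of r] r by (metis order_trans zero_le_one)
  \<comment> \<open>From here on \<open>g * \<bar>ln c\<bar> / I0\<close> outweighs the constant
    \<open>C\<close> and the 1 lost in rounding up.\<close>
  have "eventually (\<lambda>c::real. (1 + C) / g * I0 \<le> \<bar>ln c\<bar>) (at_right 0)"
    using filterlim_abs_ln_at_right_0 by (auto simp: filterlim_at_top)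
  moreover have "eventually (\<lambda>c::real. 0 < c \<and> c < 1) (at_right 0)"
    by (auto simp: eventually_at_right_field intro!: exI[of _ 1])
  ultimately show ?thesis
  proof eventually_elim
    case (elim c)
    define x where "x = \<bar>ln c\<bar> / I0"
    \<comment> \<open>The summand 1 pays for the ceiling and gives \<open>1 \<le> y\<close>, as
      \<open>powr_add_le\<close> requires.\<close>
    define y where "y = x / (1 - \<delta>) + 1"
    have x: "0 \<le> x" "(1 + C) / g \<le> x" using elim(1) I_pos by (auto simp: x_def field_simps)
    have y1: "1 \<le> y" using x \<delta> by (simp add: y_def)
    have "y + C \<le> (1 + \<epsilon>) * x"
    proof -
      have "1 + C \<le> g * x" using x(2) g by (simp add: field_simps)
      then show ?thesis by (simp add: y_def g_def algebra_simps)
    qed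
    have "real (nat \<lceil>\<bar>ln c\<bar> / ((1 - \<delta>) * I0)\<rceil>) \<le> y"
    proof -
      have "\<bar>ln c\<bar> / ((1 - \<delta>) * I0) = x / (1 - \<delta>)" by (simp add: x_def field_simps)
      moreover have "0 \<le> x / (1 - \<delta>)" using x \<delta> by simp
      ultimately show ?thesis unfolding y_def by linarith
    qed
    then have "real (nat \<lceil>\<bar>ln c\<bar> / ((1 - \<delta>) * I0)\<rceil>) powr r + C \<le> y powr r + C"
      using r by (intro add_mono powr_mono2) auto
    also have "\<dots> \<le> (y + C) powr r" using y1 C r by (intro powr_add_le)
    also have "\<dots> \<le> ((1 + \<epsilon>) * x) powr r" using \<open>y + C \<le> _\<close> y1 C r by (intro powr_mono2) auto
    finally show ?case using C(2)[of c] elim(2)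
      by (auto simp: x_def intro: order_trans ennreal_leI)
  qed
qed

section \<open>Error probability\<close>

text \<open>Allowing a separate time \<open>n\<close> at each sensor makes the event of a sensor
  depend on its own sources alone, so the probabilities multiply.\<close>

lemma all_sensors_wrong:
  assumes j: "j < M" and c: "0 < c" "c < 1"
  shows "prob (\<Inter>l\<in>{..<L}. {w \<in> space P. \<exists>n. exp (thr c j l) \<le> ratio l j n w}) \<le> c"
proof -
  let ?E = "\<lambda>l. {w \<in> space P. \<exists>n. exp (thr c j l) \<le> ratio l j n w}"
  have "indep_sets (\<lambda>l. sets (alg (sensor_idx l))) {..<L}"
    by (intro indep_sets_subalg[OF indep_gen Int_stable_gen] sensor_idx_subset)
       (auto simp: disjoint_family_on_def sensor_idx_def)
  moreover have "?E l \<in> sets (alg (sensor_idx l))" if l: "l < L" for l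
  proof -
    have [measurable]: "ratio l j n \<in> borel_measurable (alg (sensor_idx l))" for n
      by (rule measurable_subalg_mono[OF gen_events measurable_ratio[OF l j] past_idx_subset sensor_idx_subset[OF l]])
    have "{w \<in> space (alg (sensor_idx l)). \<exists>n. exp (thr c j l) \<le> ratio l j n w} \<in> sets (alg (sensor_idx l))"
      by measurable
    then show ?thesis by simp
  qed
  ultimately have "prob (\<Inter>l\<in>{..<L}. ?E l) = (\<Prod>l<L. prob (?E l))"
    using sensors_nonempty by (intro indep_setsD) auto
  also have "\<dots> \<le> (\<Prod>l<L. exp (- thr c j l))"
  proof (rule prod_mono, intro conjI)
    fix l assume l: "l \<in> {..<L}"
    \<comment> \<open>With exponent 1 and zero rates the supermartingale is the likelihood ratio
      itself.\<close>
    have "?E l = {w \<in> space P. \<exists>n. exp (thr c j l) \<le> mart l j 1 (\<lambda>_. 0) n w}"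
      using ratio_nonneg[OF _ j] l by (auto simp: mart_def)
    also have "prob \<dots> \<le> 1 / exp (thr c j l)"
      using l j sum_coeff_le_one[of l j _ 1] by (intro mart_maximal) auto
    finally show "prob (?E l) \<le> exp (- thr c j l)" by (simp add: exp_minus inverse_eq_divide)
  qed simp
  also have "\<dots> = exp (- (\<Sum>l<L. thr c j l))" by (simp add: sum_negf flip: exp_sum)
  also have "(\<Sum>l<L. thr c j l) = \<bar>ln c\<bar>"
    using Ival_pos[OF j] by (simp add: dct_thr_def rho_def flip: sum_distrib_right sum_divide_distrib)
       (simp flip: Ival_def)
  also have "exp (- \<bar>ln c\<bar>) = c" using c by simp
  finally show ?thesis .
qed

text \<open>The error event is covered by a measurable set up to a null event. Never stopping counts
  as an error but has probability zero.\<close>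

lemma error_bound:
  assumes c: "0 < c" "c < 1"
  obtains E where "E \<in> sets P" "prob E \<le> real (M - 1) * c"
    "AE w in P. N c w = \<infinity> \<or> dct_hat mu p M L Qs Z U c w \<noteq> i \<longrightarrow> w \<in> E"
proof -
  define F where "F j = (\<Inter>l\<in>{..<L}. {w \<in> space P. \<exists>n. exp (thr c j l) \<le> ratio l j n w})" for j
  have F_sets: "F j \<in> sets P" if "j < M" for j
  proof -
    have "{w \<in> space P. \<exists>n. exp (thr c j l) \<le> ratio l j n w} \<in> sets P" if "l < L" for l
    proof -
      have [measurable]: "ratio l j n \<in> borel_measurable P" for n
        by (rule measurable_ratio_P[OF that \<open>j < M\<close>])
      show ?thesis by measurable
    qed
    then show ?thesis unfolding F_def using sensors_nonempty by (intro sets.finite_INT) auto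
  qed
  show ?thesis
  proof (rule that)
    show "(\<Union>j\<in>{..<M} - {i}. F j) \<in> sets P" using F_sets by (intro sets.finite_UN) auto
    have "prob (\<Union>j\<in>{..<M} - {i}. F j) \<le> (\<Sum>j\<in>{..<M} - {i}. prob (F j))"
      using F_sets by (intro finite_measure_subadditive_finite) auto
    also have "\<dots> \<le> (\<Sum>j\<in>{..<M} - {i}. c)"
      unfolding F_def using all_sensors_wrong c by (intro sum_mono) auto
    also have "\<dots> = real (M - 1) * c" using i_lt by simp
    finally show "prob (\<Union>j\<in>{..<M} - {i}. F j) \<le> real (M - 1) * c" .
    show "AE w in P. N c w = \<infinity> \<or> dct_hat mu p M L Qs Z U c w \<noteq> i \<longrightarrow> w \<in> (\<Union>j\<in>{..<M} - {i}. F j)"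
      using AE_N_finite[OF c] AE_regular AE_space
    proof eventually_elim
      case (elim w)
      define j where "j = dct_hat mu p M L Qs Z U c w"
      from dct_hat_agree[OF L1 elim(1)] obtain n where agree: "dct_agree mu p M L Qs Z U c w n j"
        unfolding j_def by blast
      then have jM: "j < M" by (simp add: dct_agree_def)
      have "w \<in> F j" if "j \<noteq> i"
        unfolding F_def
      proof (intro INT_I CollectI conjI elim)
        fix l assume "l \<in> {..<L}"
        then have l: "l < L" by simp
        let ?Q = "\<lambda>m. m \<le> n \<and> fires p M l (thr c) (hist p M Qs Z U l w m)"
        have dec: "lastdec mu p M L Qs Z U c l w n = Some j" using agree l by (simp add: dct_agree_def)
        then have ex: "\<exists>m. ?Q m" unfolding lastdec_def by (auto split: if_splits)
        \<comment> \<open>The decision standing at time \<open>n\<close> was sent at time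
          \<open>m\<close>, when the posterior of \<open>j\<close> had passed its threshold.\<close>
        define m where "m = Greatest ?Q"
        have m: "?Q m" unfolding m_def using ex by (auto intro!: GreatestI_nat[of ?Q _ n])
        have arg: "argmax_idx M (post p M l (H l m w)) = j"
          using dec ex by (auto simp: lastdec_def H_def m_def split: if_splits)
        let ?post = "post p M l (H l m w)"
        have S: "0 < (\<Sum>k<M. lik p l (H l m w) k)"
          using M_pos by (intro sum_pos lik_pos elim l) auto
        have "exp (thr c j l) * ?post i \<le> exp (thr c j l) * Max {?post k | k. k < M \<and> k \<noteq> j}"
          using that i_lt by (intro mult_left_mono Max_ge) auto
        also have "\<dots> \<le> ?post j" using m arg by (simp add: fires_def H_def)
        finally have "exp (thr c j l) * lik p l (H l m w) i \<le> lik p l (H l m w) j"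
          using S by (simp add: post_def divide_le_cancel)
        then have "exp (thr c j l) \<le> ratio l j m w"
          using lik_pos[OF elim(2) l i_lt, of m] by (simp add: ratio_def field_simps)
        then show "\<exists>n. exp (thr c j l) \<le> ratio l j n w" by blast
      qed
      then show ?case using elim(1) jM by (auto simp: j_def)
    qed
  qed
qed

end

section \<open>Capping the randomisation variables\<close>

lemma hist_cong:
  assumes "\<And>k. 1 \<le> k \<Longrightarrow> U k l w = U' k l w"
  shows "hist p M Qs Z U l w n = hist p M Qs Z U' l w n"
  using assms by (induction n) (auto simp: Let_def)

lemma dct_agree_cong:
  assumes "\<And>k l. 1 \<le> k \<Longrightarrow> l < L \<Longrightarrow> U k l w = U' k l w"
  shows "dct_agree mu p M L Qs Z U c w = dct_agree mu p M L Qs Z U' c w"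
proof -
  have "hist p M Qs Z U l w n = hist p M Qs Z U' l w n" if "l < L" for l n
    using assms that by (intro hist_cong) auto
  then have "lastdec mu p M L Qs Z U c l w = lastdec mu p M L Qs Z U' c l w" if "l < L" for l
    using that by (simp add: lastdec_def[abs_def] cong: if_cong)
  then show ?thesis by (simp add: dct_agree_def[abs_def] fun_eq_iff)
qed

text \<open>On the null event that a randomisation variable exceeds one the sampling of actions is
  unspecified; capping these variables makes the histories well behaved everywhere.\<close>
lemma model_under_cap:
  assumes "model_under mu p M L P Z U i"
  shows "model_under mu p M L P Z (\<lambda>k l w. min 1 (U k l w)) i"
    and "AE w in P. \<forall>k l. 1 \<le> k \<longrightarrow> l < L \<longrightarrow> U k l w = min 1 (U k l w)"
proof -
  interpret prob_space P using assms by (simp add: model_under_def)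
  have U: "U k l \<in> borel_measurable P" "distr P lborel (U k l) = uniform_measure lborel {0..1}"
    if "1 \<le> k" "l < L" for k l
    using assms that by (auto simp: model_under_def)
  have le1: "AE w in P. U k l w = min 1 (U k l w)" if "1 \<le> k" "l < L" for k l
  proof -
    have "AE x in distr P lborel (U k l). x \<le> 1"
      unfolding U(2)[OF that] by (intro AE_uniform_measureI) auto
    from AE_distrD[OF _ this] U(1)[OF that] show ?thesis by (auto simp: min_def)
  qed
  then have "AE w in P. 1 \<le> k \<longrightarrow> l < L \<longrightarrow> U k l w = min 1 (U k l w)" for k l
    by (cases "1 \<le> k \<and> l < L") auto
  then show "AE w in P. \<forall>k l. 1 \<le> k \<longrightarrow> l < L \<longrightarrow> U k l w = min 1 (U k l w)"
    by (intro AE_all_countable[THEN iffD2] allI)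
  have cap: "(\<lambda>w. min 1 (U k l w)) \<in> borel_measurable P"
    "distr P lborel (\<lambda>w. min 1 (U k l w)) = uniform_measure lborel {0..1}"
    if "1 \<le> k" "l < L" for k l
  proof -
    have [measurable]: "U k l \<in> borel_measurable P" by (rule U(1)[OF that])
    show cap_meas: "(\<lambda>w. min 1 (U k l w)) \<in> borel_measurable P" by measurable
    have "distr P lborel (U k l) = distr P lborel (\<lambda>w. min 1 (U k l w))"
      using le1[OF that] by (intro distr_cong_AE) auto
    with U(2)[OF that] show "distr P lborel (\<lambda>w. min 1 (U k l w)) = uniform_measure lborel {0..1}" by simp
  qed
  \<comment> \<open>Events generated by a capped variable are among those generated by the original
    one, so independence is inherited.\<close>
  have pre: "\<exists>B. (\<lambda>w. min 1 (U k l w)) -` A \<inter> space P = U k l -` B \<inter> space P \<and> B \<in> sets borel"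
    if "A \<in> sets borel" for k l A
  proof (intro exI conjI)
    have "min (1::real) \<in> borel_measurable borel" by measurable
    from measurable_sets[OF this that] show "min 1 -` A \<in> sets borel" by simp
  qed auto
  have "indep_sets
       (\<lambda>x. case x of
              Inl (k, l, u) \<Rightarrow> {Z k l u -` A \<inter> space P | A. A \<in> sets mu}
            | Inr (k, l) \<Rightarrow> {(\<lambda>w. min 1 (U k l w)) -` A \<inter> space P | A. A \<in> sets borel})
       (Inl ` {(k, l, u). 1 \<le> k \<and> l < L \<and> u < M} \<union> Inr ` {(k, l). 1 \<le> k \<and> l < L})"
    by (rule indep_sets_mono_sets[where F = "\<lambda>x. case x of
              Inl (k, l, u) \<Rightarrow> {Z k l u -` A \<inter> space P | A. A \<in> sets mu}
            | Inr (k, l) \<Rightarrow> {U k l -` A \<inter> space P | A. A \<in> sets borel}"])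
       (use assms pre in \<open>auto simp: model_under_def split: sum.splits\<close>)
  then show "model_under mu p M L P Z (\<lambda>k l w. min 1 (U k l w)) i"
    using assms cap unfolding model_under_def by blast
qed

section \<open>The four bounds for the original variables\<close>

theorem theorem1:
  fixes mu :: "'y measure"
    and p :: "nat \<Rightarrow> nat \<Rightarrow> nat \<Rightarrow> 'y \<Rightarrow> real"
    and M L :: nat
    and Qs :: "nat \<Rightarrow> nat \<Rightarrow> nat \<Rightarrow> real"
    and P :: "'a measure"
    and Z :: "nat \<Rightarrow> nat \<Rightarrow> nat \<Rightarrow> 'a \<Rightarrow> 'y"
    and U :: "nat \<Rightarrow> nat \<Rightarrow> 'a \<Rightarrow> real"
    and i :: nat
  assumes M2: "2 \<le> M" and L1: "1 \<le> L"
    and dens: "\<And>u j l. u < M \<Longrightarrow> j < M \<Longrightarrow> l < L \<Longrightarrow>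
                 p u j l \<in> borel_measurable mu \<and> (\<forall>y \<in> space mu. 0 \<le> p u j l y) \<and>
                 (\<integral>\<^sup>+ y. ennreal (p u j l y) \<partial>mu) = 1"
    and kl_finite: "\<And>u j j' l. u < M \<Longrightarrow> j < M \<Longrightarrow> j' < M \<Longrightarrow> l < L \<Longrightarrow>
                 (AE y in mu. p u j' l y = 0 \<longrightarrow> p u j l y = 0) \<and>
                 integrable mu (\<lambda>y. p u j l y * ln (p u j l y / p u j' l y))"
    and kl_pos: "\<And>j j' l. j < M \<Longrightarrow> j' < M \<Longrightarrow> l < L \<Longrightarrow> j \<noteq> j' \<Longrightarrow>
                 \<exists>u<M. 0 < kl mu (p u j l) (p u j' l)"
    and second_moment: "\<And>u j j' l. u < M \<Longrightarrow> j < M \<Longrightarrow> j' < M \<Longrightarrow> l < L \<Longrightarrow>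
                 integrable mu (\<lambda>y. p u j l y * (ln (p u j l y / p u j' l y))\<^sup>2)"
    and Qs_opt: "\<And>l j. l < L \<Longrightarrow> j < M \<Longrightarrow>
                 Qs l j \<in> action_pmfs M \<and> chernoff_obj mu p M l j (Qs l j) = vval mu p M l j"
    and i_lt: "i < M"
    and model: "model_under mu p M L P Z U i"
  shows
    "(\<forall>c. 0 < c \<and> c < 1 \<longrightarrow>
        measure P (dct_err mu p M L Qs Z U c P i) \<le> min (real (M - 1) * c) 1)
     \<and> (\<forall>\<epsilon>>0. eventually (\<lambda>c.
          (\<integral>\<^sup>+ w. ennreal_of_enat (dct_N mu p M L Qs Z U c w) \<partial>P)
            \<le> ennreal ((1 + \<epsilon>) * \<bar>ln c\<bar> / Ival mu p M L i)) (at_right 0))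
     \<and> (\<forall>\<omega>>0. \<forall>\<epsilon>>0. eventually (\<lambda>c.
          ennreal c * (\<integral>\<^sup>+ w. ennreal_of_enat (dct_N mu p M L Qs Z U c w) \<partial>P)
            + ennreal (\<omega> * measure P (dct_err mu p M L Qs Z U c P i))
            \<le> ennreal ((1 + \<epsilon>) * c * \<bar>ln c\<bar> / Ival mu p M L i)) (at_right 0))
     \<and> (\<forall>r::real. 2 \<le> r \<longrightarrow>
          (\<forall>u j j' l. u < M \<longrightarrow> j < M \<longrightarrow> j' < M \<longrightarrow> l < L \<longrightarrow>
             integrable mu (\<lambda>y. p u j l y * \<bar>ln (p u j l y / p u j' l y)\<bar> powr r)) \<longrightarrow>
          (\<forall>\<epsilon>>0. eventually (\<lambda>c.
             (\<integral>\<^sup>+ w. enat_powr (dct_N mu p M L Qs Z U c w) r \<partial>P)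
               \<le> ennreal (((1 + \<epsilon>) * \<bar>ln c\<bar> / Ival mu p M L i) powr r)) (at_right 0)))"
proof -
  define V where "V k l w = min 1 (U k l w)" for k l w
  have V_model: "model_under mu p M L P Z V i"
    and V_eq: "AE w in P. \<forall>k l. 1 \<le> k \<longrightarrow> l < L \<longrightarrow> U k l w = V k l w"
    using model_under_cap[OF model] by (simp_all add: V_def[abs_def])
  interpret dct_model mu p M L Qs P Z V i
    using M2 L1 dens kl_finite kl_pos Qs_opt i_lt V_model
    by (intro dct_model.intro) (auto simp: V_def)
  have same: "AE w in P. dct_agree mu p M L Qs Z U c w = dct_agree mu p M L Qs Z V c w" for c
    using V_eq by eventually_elim (intro dct_agree_cong, blast)
  have N_eq: "AE w in P. dct_N mu p M L Qs Z U c w = N c w" for c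
    using same[of c] by eventually_elim (simp add: dct_N_def)
  have hat_eq: "AE w in P. dct_hat mu p M L Qs Z U c w = dct_hat mu p M L Qs Z V c w" for c
    using same[of c] by eventually_elim (simp add: dct_hat_def dct_N_def)
  have moments: "eventually (\<lambda>c. (\<integral>\<^sup>+ w. enat_powr (dct_N mu p M L Qs Z U c w) r \<partial>P)
      \<le> ennreal (((1 + \<epsilon>) * \<bar>ln c\<bar> / I0) powr r)) (at_right 0)"
    if "1 \<le> r" "0 < \<epsilon>" for r \<epsilon>
    using moment_asymptotics[OF that]
  proof eventually_elim
    case (elim c)
    have "(\<integral>\<^sup>+ w. enat_powr (dct_N mu p M L Qs Z U c w) r \<partial>P) = (\<integral>\<^sup>+ w. enat_powr (N c w) r \<partial>P)"
      using N_eq[of c] by (intro nn_integral_cong_AE, eventually_elim) simp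
    with elim show ?case by simp
  qed
  have I_pos: "0 < I0" by (rule Ival_pos[OF i_lt])
  have mean: "eventually (\<lambda>c. (\<integral>\<^sup>+ w. ennreal_of_enat (dct_N mu p M L Qs Z U c w) \<partial>P)
      \<le> ennreal ((1 + \<epsilon>) * \<bar>ln c\<bar> / I0)) (at_right 0)" if "0 < \<epsilon>" for \<epsilon>
    using moments[of 1 \<epsilon>] that I_pos by (simp add: enat_powr_one)
  have err: "prob (dct_err mu p M L Qs Z U c P i) \<le> real (M - 1) * c" if c: "0 < c" "c < 1" for c
  proof -
    obtain E where E: "E \<in> sets P" "prob E \<le> real (M - 1) * c"
      "AE w in P. N c w = \<infinity> \<or> dct_hat mu p M L Qs Z V c w \<noteq> i \<longrightarrow> w \<in> E"
      by (rule error_bound[OF c])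
    have "AE w in P. w \<in> dct_err mu p M L Qs Z U c P i \<longrightarrow> w \<in> E"
      using E(3) N_eq[of c] hat_eq[of c] by eventually_elim (auto simp: dct_err_def)
    then have "prob (dct_err mu p M L Qs Z U c P i) \<le> prob E"
      using E(1) by (rule finite_measure_mono_AE)
    with E(2) show ?thesis by simp
  qed
  have risk: "eventually (\<lambda>c. ennreal c * (\<integral>\<^sup>+ w. ennreal_of_enat (dct_N mu p M L Qs Z U c w) \<partial>P)
        + ennreal (\<omega> * prob (dct_err mu p M L Qs Z U c P i))
      \<le> ennreal ((1 + \<epsilon>) * c * \<bar>ln c\<bar> / I0)) (at_right 0)"
    if "0 < \<omega>" "0 < \<epsilon>" for \<omega> \<epsilon>
  proof -
    \<comment> \<open>Half of \<open>\<epsilon>\<close> is kept for the delay. The other half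
      absorbs the cost of errors, which is at most of order \<open>c\<close> and thus small against
      \<open>c * \<bar>ln c\<bar>\<close>.\<close>
    have half: "0 < \<epsilon> / 2" using that by simp
    have "eventually (\<lambda>c::real. \<omega> * real (M - 1) * (2 * I0 / \<epsilon>) \<le> \<bar>ln c\<bar>) (at_right 0)"
      using filterlim_abs_ln_at_right_0 by (auto simp: filterlim_at_top)
    moreover have "eventually (\<lambda>c::real. 0 < c \<and> c < 1) (at_right 0)"
      by (auto simp: eventually_at_right_field intro!: exI[of _ 1])
    ultimately show ?thesis using mean[OF half]
    proof eventually_elim
      case (elim c)
      have "\<omega> * prob (dct_err mu p M L Qs Z U c P i) \<le> \<omega> * (real (M - 1) * c)"
        using err[of c] elim that by (intro mult_left_mono) auto
      also have "\<dots> \<le> \<epsilon> / 2 * c * \<bar>ln c\<bar> / I0"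
      proof -
        have "\<omega> * real (M - 1) \<le> \<epsilon> / 2 * \<bar>ln c\<bar> / I0"
          using elim(1) that I_pos by (simp add: field_simps)
        then have "\<omega> * real (M - 1) * c \<le> \<epsilon> / 2 * \<bar>ln c\<bar> / I0 * c"
          using elim by (intro mult_right_mono) auto
        then show ?thesis by (simp add: mult_ac)
      qed
      finally have wrong: "\<omega> * prob (dct_err mu p M L Qs Z U c P i) \<le> \<epsilon> / 2 * c * \<bar>ln c\<bar> / I0" .
      have "ennreal c * (\<integral>\<^sup>+ w. ennreal_of_enat (dct_N mu p M L Qs Z U c w) \<partial>P)
            + ennreal (\<omega> * prob (dct_err mu p M L Qs Z U c P i))
          \<le> ennreal c * ennreal ((1 + \<epsilon> / 2) * \<bar>ln c\<bar> / I0) + ennreal (\<epsilon> / 2 * c * \<bar>ln c\<bar> / I0)"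
        using elim(3) wrong by (intro add_mono mult_left_mono ennreal_leI) auto
      also have "\<dots> = ennreal (c * ((1 + \<epsilon> / 2) * \<bar>ln c\<bar> / I0) + \<epsilon> / 2 * c * \<bar>ln c\<bar> / I0)"
      proof -
        have nonneg: "0 \<le> (1 + \<epsilon> / 2) * \<bar>ln c\<bar> / I0" "0 \<le> \<epsilon> / 2 * c * \<bar>ln c\<bar> / I0"
          using that elim(2) I_pos by (intro divide_nonneg_pos mult_nonneg_nonneg; simp)+
        have "0 \<le> c" using elim(2) by simp
        with nonneg show ?thesis
          by (simp only: ennreal_mult[symmetric] ennreal_plus[symmetric] mult_nonneg_nonneg)
      qed
      also have "c * ((1 + \<epsilon> / 2) * \<bar>ln c\<bar> / I0) + \<epsilon> / 2 * c * \<bar>ln c\<bar> / I0 = (1 + \<epsilon>) * c * \<bar>ln c\<bar> / I0"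
        using I_pos by (simp add: field_simps)
      finally show ?case .
    qed
  qed
  show ?thesis
    using err mean risk moments by auto
qed

end
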